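(* Let $V$ be a finite-dimensional real vector space and let $g_t$ be a smooth one-parameter family of inner products on $V$ with $g_0=g$ and $\frac{d}{dt}\big|_{t=0}g_t=h$. For $p\ge1$ let $\tilde g_t$ denote the inner product induced by $g_t$ on the space $\Lambda^pV^*\otimes\Lambda^pV^*$ of $(p,p)$ double forms, and $\tilde g_0'=\frac{d}{dt}\big|_{t=0}\tilde g_t$. Then for any $(p,p)$ double forms $\omega_1,\omega_2$, $$\tilde g_0'(\omega_1,\omega_2)=-\tilde g_0\bigl(F_h(\omega_1),\omega_2\bigr),$$ where $F_h(\omega)=\frac{g^{p-1}h}{(p-1)!}\circ\omega+\omega\circ\frac{g^{p-1}h}{(p-1)!}$ for every $(p,p)$ double form $\omega$.
   Context: A $(p,q)$ double form on $V$ is an element of $\Lambda^pV^*\otimes\Lambda^qV^*$. The exterior product of double forms is $(\alpha_1\otimes\beta_1)(\alpha_2\otimes\beta_2)=(\alpha_1\wedge\alpha_2)\otimes(\beta_1\wedge\beta_2)$; $g^{p-1}$ and $g^{p-1}h$ are computed with this product, $g$ and $h$ being symmetric bilinear forms viewed as $(1,1)$ double forms. The inner product induced by an inner product $g$ is the one for which the $e^{i_1}\wedge\dots\wedge e^{i_p}\otimes e^{j_1}\wedge\dots\wedge e^{j_q}$ (increasing indices, $(e^i)$ dual to a $g$-orthonormal basis) form an orthonormal basis. The composition product $\circ$ of two $(p,p)$ double forms is composition of the corresponding endomorphisms of $\Lambda^pV$, where $(p,p)$ double forms are identified with endomorphisms of $\Lambda^pV$ via the metric $g=g_0$ (so $g^p/p!$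 corresponds to the identity). *)

theory Defs
  imports "HOL-Analysis.Analysis" "HOL-Library.Function_Algebras"
begin

text \<open>Real-valued functions form a real vector space pointwise, so that \<^const>\<open>span\<close>,
  \<^const>\<open>linear\<close> and so on apply to spaces of forms.\<close>

instantiation "fun" :: (type, real_vector) real_vector
begin

definition scaleR_fun :: "real \<Rightarrow> ('a \<Rightarrow> 'b) \<Rightarrow> 'a \<Rightarrow> 'b"
  where "scaleR_fun c f = (\<lambda>x. c *\<^sub>R f x)"

instance
  by standard (simp_all add: scaleR_fun_def fun_eq_iff scaleR_add_left scaleR_add_right)

end

lemma scaleR_fun_apply [simp]: "(c *\<^sub>R f) x = c *\<^sub>R f x"
  by (simp add: scaleR_fun_def)


definition inner_product_on :: "'v::real_vector set \<Rightarrow> ('v \<Rightarrow> 'v \<Rightarrow> real) \<Rightarrow> bool"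
  where "inner_product_on S G \<longleftrightarrow>
    (\<forall>x\<in>S. \<forall>y\<in>S. G x y = G y x) \<and>
    (\<forall>x\<in>S. \<forall>y\<in>S. \<forall>z\<in>S. G (x + y) z = G x z + G y z) \<and>
    (\<forall>c. \<forall>x\<in>S. \<forall>y\<in>S. G (c *\<^sub>R x) y = c * G x y) \<and>
    (\<forall>x\<in>S. x \<noteq> 0 \<longrightarrow> G x x > 0)"

definition orthonormal_basis ::
    "'v::real_vector set \<Rightarrow> ('v \<Rightarrow> 'v \<Rightarrow> real) \<Rightarrow> 'i set \<Rightarrow> ('i \<Rightarrow> 'v) \<Rightarrow> bool"
  where "orthonormal_basis S G I b \<longleftrightarrow>
    (\<forall>i\<in>I. \<forall>j\<in>I. G (b i) (b j) = (if i = j then 1 else 0)) \<and> span (b ` I) = S"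


text \<open>A form of degree \<open>p\<close> is a function on lists of vectors: multilinear and alternating on lists
  of length \<open>p\<close>, and \<open>0\<close> (a convention that makes equality of forms extensional) on all others.\<close>

type_synonym 'a form = "'a list \<Rightarrow> real"

definition forms :: "nat \<Rightarrow> 'a::real_vector form set"
  where "forms p = {\<alpha>.
    (\<forall>xs. length xs \<noteq> p \<longrightarrow> \<alpha> xs = 0) \<and>
    (\<forall>xs i. length xs = p \<longrightarrow> i < p \<longrightarrow> linear (\<lambda>v. \<alpha> (xs[i := v]))) \<and>
    (\<forall>xs. length xs = p \<longrightarrow> \<not> distinct xs \<longrightarrow> \<alpha> xs = 0)}"

definition unit_form :: "'a form"
  where "unit_form xs = (if xs = [] then 1 else 0)"

definition covector_form :: "('a \<Rightarrow> real) \<Rightarrow> 'a form"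
  where "covector_form \<phi> xs = (if length xs = 1 then \<phi> (hd xs) else 0)"

text \<open>For forms of degrees \<open>a\<close> and \<open>b\<close> only the summand \<open>k = a\<close> on lists of length \<open>a + b\<close> is
  nonzero, and the normalisation is the one in which
  \<open>(e\<^sup>1 \<and> \<dots> \<and> e\<^sup>p) [e\<^sub>1, \<dots>, e\<^sub>p] = 1\<close> for dual bases.\<close>

definition wedge :: "'a form \<Rightarrow> 'a form \<Rightarrow> 'a form"
  where "wedge \<alpha> \<beta> xs =
    (\<Sum>k\<le>length xs. \<Sum>\<sigma> | \<sigma> permutes {..<length xs}.
        of_int (sign \<sigma>) * \<alpha> (take k (permute_list \<sigma> xs)) * \<beta> (drop k (permute_list \<sigma> xs))
          / (fact k * fact (length xs - k)))"

definition wedge_covectors :: "('a \<Rightarrow> real) list \<Rightarrow> 'a form"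
  where "wedge_covectors \<phi>s = foldr wedge (map covector_form \<phi>s) unit_form"


text \<open>Double forms: \<open>\<Lambda>\<^sup>pV* \<otimes> \<Lambda>\<^sup>qV*\<close> is realised as the span of the
  functions \<open>\<alpha> \<otimes> \<beta> : (x, y) \<mapsto> \<alpha> x * \<beta> y\<close>.\<close>

type_synonym 'a dform = "'a list \<Rightarrow> 'a list \<Rightarrow> real"

definition tensor :: "'a form \<Rightarrow> 'a form \<Rightarrow> 'a dform"
  where "tensor \<alpha> \<beta> = (\<lambda>xs ys. \<alpha> xs * \<beta> ys)"

definition double_forms :: "nat \<Rightarrow> nat \<Rightarrow> 'a::real_vector dform set"
  where "double_forms p q = span {tensor \<alpha> \<beta> | \<alpha> \<beta>. \<alpha> \<in> forms p \<and> \<beta> \<in> forms q}"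

text \<open>The bilinear extension of
  \<open>(\<alpha>\<^sub>1 \<otimes> \<beta>\<^sub>1) (\<alpha>\<^sub>2 \<otimes> \<beta>\<^sub>2) = (\<alpha>\<^sub>1 \<and> \<alpha>\<^sub>2) \<otimes> (\<beta>\<^sub>1 \<and> \<beta>\<^sub>2)\<close>; see the lemmas below.\<close>

definition dmult :: "'a dform \<Rightarrow> 'a dform \<Rightarrow> 'a dform"
  where "dmult \<omega> \<eta> xs ys =
    (\<Sum>k\<le>length xs. \<Sum>\<sigma> | \<sigma> permutes {..<length xs}.
     \<Sum>l\<le>length ys. \<Sum>\<tau> | \<tau> permutes {..<length ys}.
        of_int (sign \<sigma>) * of_int (sign \<tau>)
          * \<omega> (take k (permute_list \<sigma> xs)) (take l (permute_list \<tau> ys))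
          * \<eta> (drop k (permute_list \<sigma> xs)) (drop l (permute_list \<tau> ys))
          / ((fact k * fact (length xs - k)) * (fact l * fact (length ys - l))))"

lemma dmult_tensor:
  "dmult (tensor \<alpha>1 \<beta>1) (tensor \<alpha>2 \<beta>2) = tensor (wedge \<alpha>1 \<alpha>2) (wedge \<beta>1 \<beta>2)"
  unfolding fun_eq_iff dmult_def tensor_def wedge_def sum_distrib_right
  unfolding sum_distrib_left
  by (intro allI sum.cong refl) simp

lemma bilinear_dmult: "bilinear dmult"
  unfolding bilinear_def
  by (intro conjI allI linearI ext)
    (simp_all add: dmult_def sum.distrib[symmetric] sum_distrib_left add_divide_distrib
      distrib_left distrib_right mult.assoc mult.left_commute)

definition bilinear_dform :: "('a \<Rightarrow> 'a \<Rightarrow> real) \<Rightarrow> 'a dform"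
  where "bilinear_dform b xs ys =
    (if length xs = 1 \<and> length ys = 1 then b (hd xs) (hd ys) else 0)"

definition dpower :: "'a dform \<Rightarrow> nat \<Rightarrow> 'a dform"
  where "dpower \<omega> k = (dmult \<omega> ^^ k) (tensor unit_form unit_form)"


text \<open>The inner product induced by \<open>g\<close> on \<open>(p, q)\<close> double forms. For a basis \<open>e\<^sub>0, \<dots>, e\<^sub>n\<^sub>-\<^sub>1\<close> of
  \<open>V\<close>, the covector \<open>e\<^sup>i\<close> of the dual basis is the \<open>i\<close>-th coordinate function. The function chosen
  by \<open>SOME\<close> is determined by the condition on double forms, and only used there.\<close>

definition dual_basis :: "nat \<Rightarrow> (nat \<Rightarrow> 'a::real_vector) \<Rightarrow> nat \<Rightarrow> 'a \<Rightarrow> real"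
  where "dual_basis n e i = (\<lambda>v. representation (e ` {..<n}) v (e i))"

definition basis_form :: "nat \<Rightarrow> (nat \<Rightarrow> 'a::real_vector) \<Rightarrow> nat list \<Rightarrow> 'a form"
  where "basis_form n e is = wedge_covectors (map (dual_basis n e) is)"

definition increasing_indices :: "nat \<Rightarrow> nat \<Rightarrow> nat list set"
  where "increasing_indices n p = {is. length is = p \<and> sorted_wrt (<) is \<and> set is \<subseteq> {..<n}}"

definition induced_inner ::
    "('a::real_vector \<Rightarrow> 'a \<Rightarrow> real) \<Rightarrow> nat \<Rightarrow> nat \<Rightarrow> 'a dform \<Rightarrow> 'a dform \<Rightarrow> real"
  where "induced_inner g p q = (SOME G.
    inner_product_on (double_forms p q) G \<and>
    (\<exists>n e. orthonormal_basis UNIV g {..<n} e \<and>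
       orthonormal_basis (double_forms p q) G (increasing_indices n p \<times> increasing_indices n q)
         (\<lambda>(is, js). tensor (basis_form n e is) (basis_form n e js))))"


text \<open>\<open>\<Lambda>\<^sup>pV\<close> is realised inside the dual of \<open>\<Lambda>\<^sup>pV*\<close>: the \<open>p\<close>-vector
  \<open>x\<^sub>1 \<and> \<dots> \<and> x\<^sub>p\<close> is evaluation of \<open>p\<close>-forms at \<open>[x\<^sub>1, \<dots>, x\<^sub>p]\<close>.\<close>

type_synonym 'a multivector = "'a form \<Rightarrow> real"

definition wedge_vectors :: "'a::real_vector list \<Rightarrow> 'a multivector"
  where "wedge_vectors xs = (\<lambda>\<alpha>. if \<alpha> \<in> forms (length xs) then \<alpha> xs else 0)"

definition multivectors :: "nat \<Rightarrow> 'a::real_vector multivector set"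
  where "multivectors p = span (wedge_vectors ` {xs. length xs = p})"

text \<open>The inner product of a multivector \<open>\<xi>\<close> with \<open>y\<^sub>1 \<and> \<dots> \<and> y\<^sub>p\<close> is the value
  of \<open>\<xi>\<close> on the \<open>p\<close>-form \<open>g(y\<^sub>1, \<cdot>) \<and> \<dots> \<and> g(y\<^sub>p, \<cdot>)\<close>; in particular
  \<open>\<langle>x\<^sub>1 \<and> \<dots> \<and> x\<^sub>p, y\<^sub>1 \<and> \<dots> \<and> y\<^sub>p\<rangle> = det (g(x\<^sub>i, y\<^sub>j))\<close>.\<close>

definition inner_with_wedge :: "('a::real_vector \<Rightarrow> 'a \<Rightarrow> real) \<Rightarrow> 'a multivector \<Rightarrow> 'a list \<Rightarrow> real"
  where "inner_with_wedge g \<xi> ys = \<xi> (wedge_covectors (map g ys))"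

text \<open>The identification of \<open>(p, p)\<close> double forms with endomorphisms of \<open>\<Lambda>\<^sup>pV\<close> raises the second
  factor: \<open>\<alpha> \<otimes> \<beta>\<close> corresponds to \<open>\<xi> \<mapsto> \<xi>(\<alpha>) \<beta>\<^sup>#\<close>. Equivalently, \<open>\<omega>\<close> corresponds to the \<open>T\<close> with
  \<open>\<langle>T(x\<^sub>1 \<and> \<dots> \<and> x\<^sub>p), y\<^sub>1 \<and> \<dots> \<and> y\<^sub>p\<rangle> = \<omega> [x\<^sub>1, \<dots>, x\<^sub>p] [y\<^sub>1, \<dots>, y\<^sub>p]\<close>.
  The next two definitions are the two directions of this correspondence.\<close>

definition dform_to_endo ::
    "('a::real_vector \<Rightarrow> 'a \<Rightarrow> real) \<Rightarrow> nat \<Rightarrow> 'a dform \<Rightarrow> 'a multivector \<Rightarrow> 'a multivector"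
  where "dform_to_endo g p \<omega> \<xi> =
    (THE \<eta>. \<eta> \<in> multivectors p \<and>
       (\<forall>ys. length ys = p \<longrightarrow> inner_with_wedge g \<eta> ys = \<xi> (\<lambda>xs. \<omega> xs ys)))"

definition endo_to_dform ::
    "('a::real_vector \<Rightarrow> 'a \<Rightarrow> real) \<Rightarrow> nat \<Rightarrow> ('a multivector \<Rightarrow> 'a multivector) \<Rightarrow> 'a dform"
  where "endo_to_dform g p T xs ys =
    (if length xs = p \<and> length ys = p then inner_with_wedge g (T (wedge_vectors xs)) ys else 0)"

definition dcomp ::
    "('a::real_vector \<Rightarrow> 'a \<Rightarrow> real) \<Rightarrow> nat \<Rightarrow> 'a dform \<Rightarrow> 'a dform \<Rightarrow> 'a dform"
  where "dcomp g p \<omega>1 \<omega>2 = endo_to_dform g p (dform_to_endo g p \<omega>1 \<circ> dform_to_endo g p \<omega>2)"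


definition F_op ::
    "('a::real_vector \<Rightarrow> 'a \<Rightarrow> real) \<Rightarrow> ('a \<Rightarrow> 'a \<Rightarrow> real) \<Rightarrow> nat \<Rightarrow> 'a dform \<Rightarrow> 'a dform"
  where "F_op g h p \<omega> =
    (let K = (1 / fact (p - 1)) *\<^sub>R dmult (dpower (bilinear_dform g) (p - 1)) (bilinear_dform h)
     in dcomp g p K \<omega> + dcomp g p \<omega> K)"


definition smooth_on :: "real set \<Rightarrow> (real \<Rightarrow> real) \<Rightarrow> bool"
  where "smooth_on I f \<longleftrightarrow> (\<forall>n. \<forall>t\<in>I. (deriv ^^ n) f differentiable (at t))"

text \<open>On a finite-dimensional space, smoothness of a family of bilinear forms is smoothness of all
  its values.\<close>

definition smooth_family_of_inner_products ::
    "real set \<Rightarrow> (real \<Rightarrow> 'a::real_vector \<Rightarrow> 'a \<Rightarrow> real) \<Rightarrow> bool"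
  where "smooth_family_of_inner_products I g \<longleftrightarrow>
    (\<forall>t\<in>I. inner_product_on UNIV (g t)) \<and> (\<forall>x y. smooth_on I (\<lambda>t. g t x y))"

end

theory Submission
  imports Defs "HOL-Combinatorics.Multiset_Permutations"
begin

text \<open>For every \<open>g\<^sub>t\<close>-orthonormal basis \<open>e\<close>, the induced inner product of \<open>\<omega>\<close> and \<open>\<eta>\<close> is
  \<open>1/(p!)\<^sup>2\<close> times the sum of \<open>\<omega>(e\<^sub>L, e\<^sub>M) \<eta>(e\<^sub>L, e\<^sub>M)\<close> over all index lists \<open>L\<close>, \<open>M\<close> of length
  \<open>p\<close>. Rewritten in a fixed \<open>g\<^sub>0\<close>-orthonormal basis, the dependence on \<open>t\<close> sits only in products of
  entries of the inverse Gram matrix of \<open>g\<^sub>t\<close>, whose derivative at \<open>0\<close> is \<open>-h\<close>. The derivative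
  of such a product is a sum over the \<open>p\<close> slots; on alternating forms all slots contribute equally,
  and the result is the contraction with \<open>g\<^sup>p\<^sup>-\<^sup>1 h/(p - 1)!\<close>, because \<open>g\<^sup>k\<close> is the sum of
  \<open>e\<^sup>L \<otimes> e\<^sup>L\<close> over all index lists \<open>L\<close> of length \<open>k\<close>. The two factors of the double forms give
  the two terms of \<open>F\<^sub>h\<close>.\<close>

section \<open>Index lists\<close>

text \<open>The induced inner product arises from a choice, so the
  \<open>g\<^sub>t\<close>-orthonormal frame that comes with it may jump with \<open>t\<close> and
  need not tend to the frame at time 0. Hence no frame is ever differentiated. What varies is only
  the matrix \<open>dual_gram\<close>, formed from the coordinates of the moving frame in the fixed
  one. Whichever frame was chosen, this matrix is a left inverse of the Gram matrix of
  \<open>g\<^sub>t\<close>, and it is handled through that equation alone: not even its continuity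
  at 0 is known beforehand. Sums run over all index lists, repetitions allowed, rather than over
  increasing ones. Such sums factor slot by slot, so a change of frame needs multilinearity only and
  no minors; the price is one factorial for each alternating argument.\<close>

definition index_lists :: "nat \<Rightarrow> nat \<Rightarrow> nat list set"
  where "index_lists n p = {is. length is = p \<and> set is \<subseteq> {..<n}}"

lemma finite_index_lists [simp]: "finite (index_lists n p)"
  using finite_lists_length_eq[of "{..<n}" p] by (simp add: index_lists_def conj_commute)

lemma index_lists_length: "L \<in> index_lists n p \<Longrightarrow> length L = p"
  by (simp add: index_lists_def)

lemma index_lists_0 [simp]: "index_lists n 0 = {[]}"
  by (auto simp: index_lists_def)

lemma sum_index_lists_snoc:
  "(\<Sum>L\<in>index_lists n (Suc p). F L) = (\<Sum>L\<in>index_lists n p. \<Sum>a<n. F (L @ [a]))"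
proof -
  have "(\<Sum>L\<in>index_lists n (Suc p). F L) = (\<Sum>(L, a)\<in>index_lists n p \<times> {..<n}. F (L @ [a]))"
  proof (rule sum.reindex_bij_witness[of _ "\<lambda>(L, a). L @ [a]" "\<lambda>L. (butlast L, last L)"])
    fix L assume "L \<in> index_lists n (Suc p)"
    then have L: "L \<noteq> []" "length L = Suc p" "set L \<subseteq> {..<n}" by (auto simp: index_lists_def)
    show "(butlast L, last L) \<in> index_lists n p \<times> {..<n}"
      using L(2,3) last_in_set[OF L(1)] by (auto simp: index_lists_def subset_iff dest: in_set_butlastD simp del: last_in_set)
    show "(case (butlast L, last L) of (L, a) \<Rightarrow> L @ [a]) = L" using L by simp
    show "(case (butlast L, last L) of (L, a) \<Rightarrow> F (L @ [a])) = F L" using L by simp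
  qed (auto simp: index_lists_def)
  then show ?thesis by (simp add: sum.cartesian_product)
qed

lemma sum_index_lists_Cons:
  "(\<Sum>L\<in>index_lists n (Suc p). F L) = (\<Sum>a<n. \<Sum>L\<in>index_lists n p. F (a # L))"
proof -
  have "(\<Sum>L\<in>index_lists n (Suc p). F L) = (\<Sum>(a, L)\<in>{..<n} \<times> index_lists n p. F (a # L))"
    by (rule sum.reindex_bij_witness[of _ "\<lambda>(a, L). a # L" "\<lambda>L. (hd L, tl L)"])
      (auto simp: index_lists_def length_Suc_conv)
  then show ?thesis by (simp add: sum.cartesian_product)
qed

lemma permute_list_in_index_lists:
  "\<lbrakk>\<sigma> permutes {..<p}; L \<in> index_lists n p\<rbrakk> \<Longrightarrow> permute_list \<sigma> L \<in> index_lists n p"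
  by (simp add: index_lists_def)

lemma permute_list_inverse:
  assumes "\<sigma> permutes {..<length xs}"
  shows "permute_list \<sigma> (permute_list (inv \<sigma>) xs) = xs"
    and "permute_list (inv \<sigma>) (permute_list \<sigma> xs) = xs"
  using assms permutes_inv[OF assms]
  by (simp_all add: permute_list_compose[symmetric] permutes_inv_o)

lemma sum_index_lists_permute:
  assumes "\<sigma> permutes {..<p}"
  shows "(\<Sum>L\<in>index_lists n p. F (permute_list \<sigma> L)) = (\<Sum>L\<in>index_lists n p. F L)"
  by (rule sum.reindex_bij_witness[of _ "permute_list (inv \<sigma>)" "permute_list \<sigma>"])
    (use assms in \<open>auto simp: index_lists_length
      intro!: permute_list_inverse permute_list_in_index_lists permutes_inv\<close>)

text \<open>The distributive law, with one index picked in each slot. It turns a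
  \<open>p\<close>-fold product of sums over a frame into a single sum over lists of frame
  indices.\<close>

lemma prod_sum_index_lists:
  fixes f :: "nat \<Rightarrow> nat \<Rightarrow> 'c::comm_semiring_1"
  shows "(\<Prod>k<p. \<Sum>a<n. f k a) = (\<Sum>L\<in>index_lists n p. \<Prod>k<p. f k (L ! k))"
proof (induction p)
  case (Suc p)
  have "(\<Sum>L\<in>index_lists n (Suc p). \<Prod>k<Suc p. f k (L ! k)) =
      (\<Sum>L\<in>index_lists n p. \<Sum>a<n. (\<Prod>k<p. f k (L ! k)) * f p a)"
    unfolding sum_index_lists_snoc
    by (intro sum.cong refl) (simp add: nth_append index_lists_length)
  also have "\<dots> = (\<Prod>k<p. \<Sum>a<n. f k a) * (\<Sum>a<n. f p a)"
    unfolding Suc.IH by (simp add: sum_product)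
  finally show ?case by simp
qed simp

lemma finite_increasing_indices [simp]: "finite (increasing_indices n p)"
  by (rule finite_subset[OF _ finite_index_lists[of n p]])
    (auto simp: increasing_indices_def index_lists_def)

lemma increasing_indices_subset: "increasing_indices n p \<subseteq> index_lists n p"
  by (auto simp: increasing_indices_def index_lists_def)

text \<open>Lists with a repetition drop out. The others are grouped by their sorted version, and
  each group consists of the \<open>p!\<close> permutations of one increasing list, on which
  \<open>F\<close> is constant.\<close>

lemma sum_index_lists_symmetric:
  fixes F :: "nat list \<Rightarrow> real"
  assumes nondistinct: "\<And>L. \<lbrakk>L \<in> index_lists n p; \<not> distinct L\<rbrakk> \<Longrightarrow> F L = 0"
    and permute: "\<And>L \<sigma>. \<lbrakk>L \<in> index_lists n p; \<sigma> permutes {..<p}\<rbrakk>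
      \<Longrightarrow> F (permute_list \<sigma> L) = F L"
  shows "(\<Sum>L\<in>index_lists n p. F L) = fact p * (\<Sum>I\<in>increasing_indices n p. F I)"
proof -
  let ?D = "{L \<in> index_lists n p. distinct L}"
  have "(\<Sum>L\<in>index_lists n p. F L) = (\<Sum>L\<in>?D. F L)"
    by (rule sum.mono_neutral_right) (auto simp: nondistinct)
  also have "\<dots> = (\<Sum>I\<in>increasing_indices n p. \<Sum>L | L \<in> ?D \<and> sort L = I. F L)"
  proof (rule sum.group[symmetric])
    show "sort ` ?D \<subseteq> increasing_indices n p"
      by (auto simp: index_lists_def increasing_indices_def sorted_wrt_mono_rel
          strict_sorted_iff)
  qed simp_all
  also have "\<dots> = (\<Sum>I\<in>increasing_indices n p. fact p * F I)"
  proof (rule sum.cong[OF refl])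
    fix I assume I: "I \<in> increasing_indices n p"
    then have I': "distinct I" "sorted I" "length I = p" "set I \<subseteq> {..<n}"
      by (auto simp: increasing_indices_def strict_sorted_iff)
    have sort_iff: "sort L = I \<longleftrightarrow> set L = set I" if "distinct L" for L
      using that I' by (metis distinct_sort set_sort sorted_distinct_set_unique sorted_sort)
    have eq: "{L \<in> ?D. sort L = I} = permutations_of_set (set I)"
    proof (intro set_eqI iffI)
      fix L assume "L \<in> permutations_of_set (set I)"
      then have L: "set L = set I" "distinct L" by (auto simp: permutations_of_set_def)
      then have "length L = p" using I' by (metis distinct_card)
      then show "L \<in> {L \<in> ?D. sort L = I}" using L I' sort_iff by (auto simp: index_lists_def)
    qed (auto simp: permutations_of_set_def sort_iff)
    have "F L = F I" if "L \<in> permutations_of_set (set I)" for L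
    proof -
      have "mset L = mset I"
        using that I' by (auto simp: permutations_of_set_def set_eq_iff_mset_eq_distinct)
      then obtain \<sigma> where "\<sigma> permutes {..<length I}" "permute_list \<sigma> I = L"
        by (rule mset_eq_permutation)
      then show ?thesis using permute[of I \<sigma>] I increasing_indices_subset I' by (auto simp: subset_iff)
    qed
    then show "(\<Sum>L | L \<in> ?D \<and> sort L = I. F L) = fact p * F I"
      unfolding eq using I' by (simp add: distinct_card)
  qed
  finally show ?thesis by (simp add: sum_distrib_left)
qed

section \<open>Forms as determinants\<close>

definition tensor_eval :: "('a \<Rightarrow> real) list \<Rightarrow> 'a list \<Rightarrow> real"
  where "tensor_eval \<phi>s xs = (\<Prod>i<length \<phi>s. (\<phi>s ! i) (xs ! i))"

text \<open>The Leibniz formula for the determinant with entries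
  \<open>\<phi>\<^sub>i(x\<^sub>j)\<close>. It serves as a closed form for the nested sums hidden in
  an iterated \<open>wedge\<close>.\<close>

definition covector_det :: "('a \<Rightarrow> real) list \<Rightarrow> 'a form"
  where "covector_det \<phi>s xs =
    (if length xs = length \<phi>s
     then \<Sum>\<sigma> | \<sigma> permutes {..<length xs}. of_int (sign \<sigma>) * tensor_eval \<phi>s (permute_list \<sigma> xs)
     else 0)"

lemma tensor_eval_append:
  assumes "length us = length \<phi>s"
  shows "tensor_eval (\<phi>s @ \<psi>s) (us @ vs) = tensor_eval \<phi>s us * tensor_eval \<psi>s vs"
proof -
  have *: "{..<length \<phi>s + length \<psi>s} = {..<length \<phi>s} \<union> (\<lambda>i. length \<phi>s + i) ` {..<length \<psi>s}"
  proof (rule set_eqI)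
    show "x \<in> {..<length \<phi>s + length \<psi>s} \<longleftrightarrow>
        x \<in> {..<length \<phi>s} \<union> (\<lambda>i. length \<phi>s + i) ` {..<length \<psi>s}" for x
      by (cases "x < length \<phi>s") (auto intro!: image_eqI[where x = "x - length \<phi>s"])
  qed
  have "tensor_eval (\<phi>s @ \<psi>s) (us @ vs) = (\<Prod>i<length \<phi>s. ((\<phi>s @ \<psi>s) ! i) ((us @ vs) ! i)) *
      (\<Prod>i\<in>(\<lambda>i. length \<phi>s + i) ` {..<length \<psi>s}. ((\<phi>s @ \<psi>s) ! i) ((us @ vs) ! i))"
    unfolding tensor_eval_def length_append * by (rule prod.union_disjoint) auto
  then show ?thesis using assms
    by (simp add: tensor_eval_def prod.reindex nth_append)
qed

lemma permutation_sign_compose: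
  assumes "\<sigma> permutes {..<n::nat}" "\<tau> permutes {..<n}"
  shows "sign (\<sigma> \<circ> \<tau>) = sign \<sigma> * sign \<tau>"
  using assms by (meson finite_lessThan permutes_imp_permutation sign_compose)

text \<open>Left composition with \<sigma> permutes the summation range, and permuting by \<sigma>
  and then by \<tau> is permuting by \<open>\<sigma> \<circ> \<tau>\<close>.\<close>

lemma covector_det_permute:
  assumes \<sigma>: "\<sigma> permutes {..<length xs}"
  shows "covector_det \<phi>s (permute_list \<sigma> xs) = of_int (sign \<sigma>) * covector_det \<phi>s xs"
proof (cases "length xs = length \<phi>s")
  case True
  let ?S = "{\<tau>. \<tau> permutes {..<length xs}}"
  have "covector_det \<phi>s xs = (\<Sum>\<tau>\<in>?S. of_int (sign \<tau>) * tensor_eval \<phi>s (permute_list \<tau> xs))"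
    using True by (simp add: covector_det_def)
  also have "\<dots> = (\<Sum>\<tau>\<in>?S. of_int (sign (\<sigma> \<circ> \<tau>)) * tensor_eval \<phi>s (permute_list (\<sigma> \<circ> \<tau>) xs))"
    by (rule setum_permutations_compose_left[OF \<sigma>])
  also have "\<dots> = (\<Sum>\<tau>\<in>?S. of_int (sign \<sigma>) *
      (of_int (sign \<tau>) * tensor_eval \<phi>s (permute_list \<tau> (permute_list \<sigma> xs))))"
    using \<sigma> by (intro sum.cong refl) (simp add: permutation_sign_compose permute_list_compose)
  also have "\<dots> = of_int (sign \<sigma>) * covector_det \<phi>s (permute_list \<sigma> xs)"
    using True by (simp add: covector_det_def sum_distrib_left)
  finally show ?thesis by (metis (no_types) mult.assoc mult_1 of_int_1 of_int_mult sign_idempotent)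
qed (simp add: covector_det_def)

text \<open>Expanding both determinants gives a sum over \<sigma> and over pairs \<tau>, \<rho>
  acting on the first and on the last block of arguments. Such a pair is itself a permutation of all
  positions and is absorbed by \<sigma>; the \<open>fact ?m * fact ?n\<close> pairs then contribute
  equally and cancel the normalisation of \<open>wedge\<close>.\<close>

lemma wedge_covector_det:
  "wedge (covector_det \<phi>s) (covector_det \<psi>s) = covector_det (\<phi>s @ \<psi>s)"
proof
  fix xs :: "'a list"
  let ?m = "length \<phi>s" and ?n = "length \<psi>s" and ?N = "length xs"
  define t where "t k = (\<Sum>\<sigma> | \<sigma> permutes {..<?N}. of_int (sign \<sigma>)
      * covector_det \<phi>s (take k (permute_list \<sigma> xs))
      * covector_det \<psi>s (drop k (permute_list \<sigma> xs)) / (fact k * fact (?N - k)))" for k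
  have wedge: "wedge (covector_det \<phi>s) (covector_det \<psi>s) xs = (\<Sum>k\<le>?N. t k)"
    by (simp add: wedge_def t_def)
  \<comment> \<open>A wrong cut \<open>k\<close> or a wrong total length leaves a factor with an
    argument of the wrong length, where \<open>covector_det\<close> is 0 by convention.\<close>
  have t0: "t k = 0" if "k \<le> ?N" "k \<noteq> ?m \<or> ?N \<noteq> ?m + ?n" for k
    unfolding t_def by (rule sum.neutral) (use that in \<open>auto simp: covector_det_def min_def\<close>)
  show "wedge (covector_det \<phi>s) (covector_det \<psi>s) xs = covector_det (\<phi>s @ \<psi>s) xs"
  proof (cases "?N = ?m + ?n")
    case False
    then show ?thesis by (simp add: wedge t0 covector_det_def)
  next
    case True
    let ?P = "\<lambda>k::nat. {\<sigma>. \<sigma> permutes {..<k}}"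
    \<comment> \<open>The shift transports \<rho> from the index range of the second block to the
      last positions of the whole list.\<close>
    let ?f = "\<lambda>i. ?m + i"
    let ?T = "\<lambda>\<sigma>. of_int (sign \<sigma>) * tensor_eval (\<phi>s @ \<psi>s) (permute_list \<sigma> xs)"
    have im: "?f ` {..<?n} \<subseteq> {..<?N}" using True by auto
    have "(\<Sum>k\<le>?N. t k) = (\<Sum>k\<in>{?m}. t k)"
      by (rule sum.mono_neutral_right) (use True t0 in auto)
    also have "\<dots> = (\<Sum>\<sigma>\<in>?P ?N. \<Sum>\<tau>\<in>?P ?m. \<Sum>\<rho>\<in>?P ?n.
        ?T (\<sigma> \<circ> (\<tau> \<circ> map_permutation {..<?n} ?f \<rho>))) / (fact ?m * fact ?n)"
    proof -
      have key: "of_int (sign \<sigma>)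
          * (of_int (sign \<tau>) * tensor_eval \<phi>s (permute_list \<tau> (take ?m (permute_list \<sigma> xs))))
          * (of_int (sign \<rho>) * tensor_eval \<psi>s (permute_list \<rho> (drop ?m (permute_list \<sigma> xs))))
          = ?T (\<sigma> \<circ> (\<tau> \<circ> map_permutation {..<?n} ?f \<rho>))"
        if \<sigma>: "\<sigma> permutes {..<?N}" and \<tau>: "\<tau> permutes {..<?m}" and \<rho>: "\<rho> permutes {..<?n}"
        for \<sigma> \<tau> \<rho>
      proof -
        let ?\<rho> = "map_permutation {..<?n} ?f \<rho>" and ?ys = "permute_list \<sigma> xs"
        have \<rho>': "?\<rho> permutes ?f ` {..<?n}"
          by (rule map_permutation_permutes[OF _ \<rho>]) (simp add: bij_betw_def)
        have 1: "\<tau> permutes {..<?N}" by (rule permutes_subset[OF \<tau>]) (use True in auto)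
        have 2: "?\<rho> permutes {..<?N}" by (rule permutes_subset[OF \<rho>' im])
        have 3: "(\<tau> \<circ> ?\<rho>) permutes {..<?N}" by (rule permutes_compose[OF 2 1])
        have sgn: "sign ?\<rho> = sign \<rho>" by (rule sign_map_permutation[OF _ \<rho>]) simp_all
        have "permute_list (\<tau> \<circ> ?\<rho>) ?ys = permute_list \<tau> (take ?m ?ys) @ permute_list \<rho> (drop ?m ?ys)"
        proof (rule nth_equalityI)
          fix i assume "i < length (permute_list (\<tau> \<circ> ?\<rho>) ?ys)"
          then have i: "i < ?N" by simp
          show "permute_list (\<tau> \<circ> ?\<rho>) ?ys ! i
              = (permute_list \<tau> (take ?m ?ys) @ permute_list \<rho> (drop ?m ?ys)) ! i"
          proof (cases "i < ?m")
            case i': True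
            have "?\<rho> i = i" by (rule permutes_not_in[OF \<rho>']) (use i' in auto)
            moreover have "\<tau> i < ?m" using permutes_in_image[OF \<tau>, of i] i' by simp
            ultimately show ?thesis
              using i i' True by (simp add: permute_list_def nth_append)
          next
            case False
            then obtain j where j: "i = ?m + j" by (metis le_add_diff_inverse not_less)
            then have j': "j < ?n" using i True by simp
            have "?\<rho> (?m + j) = ?m + \<rho> j"
              using j' by (subst map_permutation_apply) auto
            moreover have "\<tau> (?m + \<rho> j) = ?m + \<rho> j" by (rule permutes_not_in[OF \<tau>]) simp
            moreover have "\<rho> j < ?n" using permutes_in_image[OF \<rho>, of j] j' by simp
            ultimately show ?thesis
              using i j j' True by (simp add: permute_list_def nth_append)
          qed
        qed (use True in auto)
        then have "tensor_eval (\<phi>s @ \<psi>s) (permute_list (\<sigma> \<circ> (\<tau> \<circ> ?\<rho>)) xs)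
            = tensor_eval \<phi>s (permute_list \<tau> (take ?m ?ys)) * tensor_eval \<psi>s (permute_list \<rho> (drop ?m ?ys))"
          using True by (simp add: permute_list_compose[OF 3] tensor_eval_append)
        moreover have "sign (\<sigma> \<circ> (\<tau> \<circ> ?\<rho>)) = sign \<sigma> * sign \<tau> * sign \<rho>"
          using permutation_sign_compose[OF \<sigma> 3] permutation_sign_compose[OF 1 2] sgn by simp
        ultimately show ?thesis by simp
      qed
      have "t ?m = (\<Sum>\<sigma>\<in>?P ?N. \<Sum>\<tau>\<in>?P ?m. \<Sum>\<rho>\<in>?P ?n. of_int (sign \<sigma>)
          * (of_int (sign \<tau>) * tensor_eval \<phi>s (permute_list \<tau> (take ?m (permute_list \<sigma> xs))))
          * (of_int (sign \<rho>) * tensor_eval \<psi>s (permute_list \<rho> (drop ?m (permute_list \<sigma> xs)))))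
          / (fact ?m * fact ?n)"
        unfolding t_def sum_divide_distrib
        by (rule sum.cong[OF refl])
          (simp add: True covector_det_def sum_distrib_left sum_distrib_right sum_divide_distrib,
            rule sum.swap)
      then show ?thesis by (simp add: key)
    qed
    also have "(\<Sum>\<sigma>\<in>?P ?N. \<Sum>\<tau>\<in>?P ?m. \<Sum>\<rho>\<in>?P ?n. ?T (\<sigma> \<circ> (\<tau> \<circ> map_permutation {..<?n} ?f \<rho>)))
        = (\<Sum>\<tau>\<in>?P ?m. \<Sum>\<rho>\<in>?P ?n. \<Sum>\<sigma>\<in>?P ?N. ?T (\<sigma> \<circ> (\<tau> \<circ> map_permutation {..<?n} ?f \<rho>)))"
      by (subst sum.swap, rule sum.cong[OF refl], rule sum.swap)
    \<comment> \<open>Right translation by a fixed permutation is a bijection, so the inner sum over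
      \<sigma> is the same for all pairs \<tau>, \<rho>.\<close>
    also have "\<dots> = (\<Sum>\<tau>\<in>?P ?m. \<Sum>\<rho>\<in>?P ?n. \<Sum>\<sigma>\<in>?P ?N. ?T \<sigma>)"
    proof (rule sum.cong[OF refl], rule sum.cong[OF refl])
      fix \<tau> \<rho> assume "\<tau> \<in> ?P ?m" "\<rho> \<in> ?P ?n"
      then have "\<tau> permutes {..<?N}" "map_permutation {..<?n} ?f \<rho> permutes {..<?N}"
        using True im
        by (auto intro: permutes_subset permutes_subset[OF map_permutation_permutes] simp: bij_betw_def)
      then have "(\<tau> \<circ> map_permutation {..<?n} ?f \<rho>) permutes {..<?N}"
        by (rule permutes_compose[rotated])
      then show "(\<Sum>\<sigma>\<in>?P ?N. ?T (\<sigma> \<circ> (\<tau> \<circ> map_permutation {..<?n} ?f \<rho>))) = (\<Sum>\<sigma>\<in>?P ?N. ?T \<sigma>)"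
        by (rule sum_permutations_compose_right[symmetric])
    qed
    also have "\<dots> = fact ?m * fact ?n * covector_det (\<phi>s @ \<psi>s) xs"
      using True by (simp add: covector_det_def card_permutations)
    finally show ?thesis by (simp add: wedge)
  qed
qed

lemma covector_form_eq_det: "covector_form \<phi> = covector_det [\<phi>]"
proof
  fix xs :: "'a list"
  have "{\<sigma>. \<sigma> permutes {..<Suc 0}} = {id}" by (simp add: lessThan_Suc)
  then show "covector_form \<phi> xs = covector_det [\<phi>] xs"
    by (auto simp: covector_form_def covector_det_def tensor_eval_def length_Suc_conv)
qed

lemma unit_form_eq_det: "unit_form = covector_det []"
proof
  fix xs :: "'a list"
  have "{\<sigma>. \<forall>x::nat. \<sigma> x = x} = {id}" by auto
  then show "unit_form xs = covector_det [] xs"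
    by (simp add: unit_form_def covector_det_def tensor_eval_def)
qed

lemma wedge_covectors_Cons:
  "wedge_covectors (\<phi> # \<phi>s) = wedge (covector_form \<phi>) (wedge_covectors \<phi>s)"
  by (simp add: wedge_covectors_def)

lemma wedge_covectors_eq_det: "wedge_covectors \<phi>s = covector_det \<phi>s"
proof (induction \<phi>s)
  case Nil
  then show ?case by (simp add: wedge_covectors_def unit_form_eq_det)
next
  case (Cons \<phi> \<phi>s)
  then show ?case using wedge_covector_det[of "[\<phi>]" \<phi>s]
    by (simp add: wedge_covectors_Cons covector_form_eq_det)
qed

section \<open>Alternating forms: permutation of arguments and expansion in coordinates\<close>

lemma formsD:
  assumes "\<alpha> \<in> forms p"
  shows "length xs \<noteq> p \<Longrightarrow> \<alpha> xs = 0"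
    and "\<lbrakk>length xs = p; i < p\<rbrakk> \<Longrightarrow> linear (\<lambda>v. \<alpha> (xs[i := v]))"
    and "\<not> distinct xs \<Longrightarrow> \<alpha> xs = 0"
  using assms by (auto simp: forms_def)

lemma subspace_forms: "subspace (forms p)"
  unfolding subspace_def forms_def
  by (auto simp: linear_iff distrib_left scaleR_add_right)

lemma permute_list_transpose:
  assumes "i < length xs" "j < length xs"
  shows "permute_list (Transposition.transpose i j) xs = xs[i := xs ! j, j := xs ! i]"
  using assms
  by (intro nth_equalityI) (auto simp: permute_list_def Transposition.transpose_def nth_list_update)

text \<open>In each Leibniz term slot \<open>i\<close> is read by exactly one covector, the one with
  index \<open>inv \<sigma> i\<close>, which gives linearity. A list with a repeated entry is fixed
  by the transposition of the two positions, whose sign is -1, so its value equals its own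
  negative.\<close>

lemma covector_det_in_forms:
  fixes \<phi>s :: "('a::real_vector \<Rightarrow> real) list"
  assumes "\<And>\<phi>. \<phi> \<in> set \<phi>s \<Longrightarrow> linear \<phi>"
  shows "covector_det \<phi>s \<in> forms (length \<phi>s)"
proof -
  have "linear (\<lambda>v. covector_det \<phi>s (xs[i := v]))"
    if len: "length xs = length \<phi>s" and i: "i < length \<phi>s" for xs i
  proof -
    have lin: "linear (\<lambda>v. tensor_eval \<phi>s (permute_list \<sigma> (xs[i := v])))"
      if \<sigma>: "\<sigma> permutes {..<length \<phi>s}" for \<sigma>
    proof -
      define j where "j = inv \<sigma> i"
      have j: "j < length \<phi>s" "\<sigma> j = i"
        using permutes_in_image[OF permutes_inv[OF \<sigma>], of i] i permutes_inverses(1)[OF \<sigma>]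
        by (auto simp: j_def)
      have other: "xs[i := v] ! \<sigma> k = xs ! \<sigma> k" if "k \<noteq> j" for k v
        using that permutes_inverses(2)[OF \<sigma>] by (metis j_def nth_list_update_neq)
      have "tensor_eval \<phi>s (permute_list \<sigma> (xs[i := v])) =
          (\<phi>s ! j) v * (\<Prod>k\<in>{..<length \<phi>s} - {j}. (\<phi>s ! k) (xs ! \<sigma> k))" for v
      proof -
        have "tensor_eval \<phi>s (permute_list \<sigma> (xs[i := v])) =
            (\<Prod>k<length \<phi>s. (\<phi>s ! k) (xs[i := v] ! \<sigma> k))"
          unfolding tensor_eval_def
          by (rule prod.cong) (use len \<sigma> in \<open>auto simp: permute_list_nth\<close>)
        also have "\<dots> = (\<phi>s ! j) (xs[i := v] ! \<sigma> j) *
            (\<Prod>k\<in>{..<length \<phi>s} - {j}. (\<phi>s ! k) (xs[i := v] ! \<sigma> k))"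
          using j by (intro prod.remove) auto
        also have "\<dots> = (\<phi>s ! j) v * (\<Prod>k\<in>{..<length \<phi>s} - {j}. (\<phi>s ! k) (xs ! \<sigma> k))"
          using j i len other by (intro arg_cong2[of _ _ _ _ "(*)"] prod.cong) auto
        finally show ?thesis .
      qed
      moreover have "linear (\<phi>s ! j)" using assms j by simp
      ultimately show ?thesis by (simp add: linear_iff algebra_simps)
    qed
    show ?thesis
      unfolding covector_det_def length_list_update
      using len lin
      by (auto simp: linear_iff sum.distrib[symmetric] sum_distrib_left distrib_left
          mult.left_commute intro!: sum.cong)
  qed
  moreover have "covector_det \<phi>s xs = 0" if "length xs = length \<phi>s" and nd: "\<not> distinct xs" for xs
  proof -
    obtain i j where ij: "i < length xs" "j < length xs" "i \<noteq> j" "xs ! i = xs ! j"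
      using nd unfolding distinct_conv_nth by blast
    then have "permute_list (Transposition.transpose i j) xs = xs"
      by (metis list_update_id permute_list_transpose)
    then show ?thesis
      using covector_det_permute[of "Transposition.transpose i j" xs \<phi>s] ij
      by (simp add: permutes_swap_id sign_swap_id)
  qed
  moreover have "covector_det \<phi>s xs = 0" if "length xs \<noteq> length \<phi>s" for xs
    using that by (simp add: covector_det_def)
  ultimately show ?thesis by (simp add: forms_def)
qed

text \<open>Polarisation: \<open>forms\<close> only demands vanishing on repeated arguments, so the
  sum of the two entries is put into both slots and expanded.\<close>

lemma forms_swap:
  assumes \<alpha>: "\<alpha> \<in> forms p" and len: "length xs = p" and ij: "i < p" "j < p" "i \<noteq> j"
  shows "\<alpha> (permute_list (Transposition.transpose i j) xs) = - \<alpha> xs"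
proof -
  let ?F = "\<lambda>u v. \<alpha> (xs[i := u, j := v])"
  have lin: "?F (u + u') v = ?F u v + ?F u' v" "?F u (v + v') = ?F u v + ?F u v'" for u u' v v'
    using linear_add[OF formsD(2)[OF \<alpha>, of "xs[j := v]" i]]
      linear_add[OF formsD(2)[OF \<alpha>, of "xs[i := u]" j]] len ij
    by (simp_all add: list_update_swap)
  have diag: "?F u u = 0" for u
  proof (rule formsD(3)[OF \<alpha>])
    show "\<not> distinct (xs[i := u, j := u])"
      using len ij nth_eq_iff_index_eq[of "xs[i := u, j := u]" i j] by (auto simp: nth_list_update)
  qed
  have "?F (xs ! i + xs ! j) (xs ! i + xs ! j) = ?F (xs ! i) (xs ! j) + ?F (xs ! j) (xs ! i)"
    using diag[of "xs ! i"] diag[of "xs ! j"] by (simp only: lin)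
  then have "\<alpha> xs + \<alpha> (xs[i := xs ! j, j := xs ! i]) = 0"
    unfolding diag list_update_id by (rule sym)
  then show ?thesis using ij len by (simp add: permute_list_transpose)
qed

lemma forms_permute:
  assumes \<alpha>: "\<alpha> \<in> forms p" and "length xs = p" and \<sigma>: "\<sigma> permutes {..<p}"
  shows "\<alpha> (permute_list \<sigma> xs) = of_int (sign \<sigma>) * \<alpha> xs"
proof -
  have "finite {..<p}" by simp
  then show ?thesis using \<sigma> \<open>length xs = p\<close>
  proof (induction \<sigma> rule: permutes_rev_induct)
    case (swap i j \<sigma>)
    have t: "Transposition.transpose i j permutes {..<p}" using swap by (simp add: permutes_swap_id)
    have "permute_list (\<sigma> \<circ> Transposition.transpose i j) xs =
        permute_list (Transposition.transpose i j) (permute_list \<sigma> xs)"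
      by (rule permute_list_compose) (use swap t in simp)
    moreover have "sign (\<sigma> \<circ> Transposition.transpose i j) = - sign \<sigma>"
      using permutation_sign_compose[OF _ t, of \<sigma>] swap by (simp add: sign_swap_id)
    ultimately show ?case
      using swap forms_swap[OF \<alpha>, of "permute_list \<sigma> xs" i j] by (simp only:) simp
  qed simp
qed

text \<open>The slots are expanded one after another; in the induction the first \<open>k\<close>
  slots already hold frame vectors and the others still hold the original arguments.\<close>

lemma forms_multilinear_expansion:
  fixes e :: "nat \<Rightarrow> 'a::real_vector"
  assumes \<alpha>: "\<alpha> \<in> forms p" and len: "length xs = p"
    and coord: "\<And>v. v = (\<Sum>a<n. c a v *\<^sub>R e a)"
  shows "\<alpha> xs = (\<Sum>L\<in>index_lists n p. tensor_eval (map c L) xs * \<alpha> (map e L))"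
proof -
  have "\<alpha> xs = (\<Sum>L\<in>index_lists n k. (\<Prod>j<k. c (L ! j) (xs ! j)) * \<alpha> (map e L @ drop k xs))"
    if "k \<le> p" for k
    using that
  proof (induction k)
    case (Suc k)
    have step: "\<alpha> (map e L @ drop k xs) =
        (\<Sum>a<n. c a (xs ! k) * \<alpha> (map e (L @ [a]) @ drop (Suc k) xs))"
      if L: "L \<in> index_lists n k" for L
    proof -
      let ?zs = "map e L @ drop k xs"
      have upd: "?zs[k := v] = map e L @ v # drop (Suc k) xs" for v
        using index_lists_length[OF L] Suc.prems len by (simp add: list_update_append Cons_nth_drop_Suc[symmetric])
      have l: "linear (\<lambda>v. \<alpha> (map e L @ v # drop (Suc k) xs))"
        using formsD(2)[OF \<alpha>, of ?zs k] index_lists_length[OF L] Suc.prems len by (simp add: upd)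
      have "\<alpha> ?zs = \<alpha> (map e L @ (\<Sum>a<n. c a (xs ! k) *\<^sub>R e a) # drop (Suc k) xs)"
        using Suc.prems len coord[of "xs ! k"] by (simp add: Cons_nth_drop_Suc)
      also have "\<dots> = (\<Sum>a<n. c a (xs ! k) *\<^sub>R \<alpha> (map e L @ e a # drop (Suc k) xs))"
        using linear_sum[OF l, of "\<lambda>a. c a (xs ! k) *\<^sub>R e a" "{..<n}"] linear_scale[OF l] by simp
      finally show ?thesis by simp
    qed
    have "\<alpha> xs = (\<Sum>L\<in>index_lists n k. (\<Prod>j<k. c (L ! j) (xs ! j)) * \<alpha> (map e L @ drop k xs))"
      using Suc by simp
    also have "\<dots> = (\<Sum>L\<in>index_lists n k. \<Sum>a<n.
        (\<Prod>j<Suc k. c ((L @ [a]) ! j) (xs ! j)) * \<alpha> (map e (L @ [a]) @ drop (Suc k) xs))"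
      by (intro sum.cong refl, subst step) (auto simp: sum_distrib_left nth_append mult.assoc index_lists_length)
    finally show ?case by (simp only: sum_index_lists_snoc)
  qed simp
  from this[of p] show ?thesis
    using len by (auto simp: tensor_eval_def index_lists_length intro!: sum.cong prod.cong)
qed

text \<open>The multilinear expansion is averaged, with signs, over all permutations of the
  arguments. This leaves \<alpha> unchanged and turns each product of coordinates into a
  determinant; the average is the origin of \<open>fact p\<close>.\<close>

lemma forms_expansion:
  fixes e :: "nat \<Rightarrow> 'a::real_vector"
  assumes \<alpha>: "\<alpha> \<in> forms p" and coord: "\<And>v. v = (\<Sum>a<n. c a v *\<^sub>R e a)"
  shows "\<alpha> xs = (\<Sum>L\<in>index_lists n p. \<alpha> (map e L) * covector_det (map c L) xs) / fact p"
proof (cases "length xs = p")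
  case len: True
  let ?P = "{\<sigma>. \<sigma> permutes {..<p}}"
  have "fact p * \<alpha> xs = (\<Sum>\<sigma>\<in>?P. of_int (sign \<sigma>) * \<alpha> (permute_list \<sigma> xs))"
    using len by (simp add: forms_permute[OF \<alpha>] mult.assoc[symmetric] of_int_mult[symmetric]
        card_permutations del: of_int_mult)
  also have "\<dots> = (\<Sum>\<sigma>\<in>?P. \<Sum>L\<in>index_lists n p. \<alpha> (map e L) *
      (of_int (sign \<sigma>) * tensor_eval (map c L) (permute_list \<sigma> xs)))"
    by (intro sum.cong refl, subst forms_multilinear_expansion[OF \<alpha> _ coord])
      (auto simp: len sum_distrib_left algebra_simps)
  also have "\<dots> = (\<Sum>L\<in>index_lists n p. \<alpha> (map e L) * covector_det (map c L) xs)"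
    by (subst sum.swap) (simp add: covector_det_def len index_lists_length sum_distrib_left)
  finally show ?thesis by (simp add: field_simps)
next
  case False
  then show ?thesis using \<alpha> by (auto simp: formsD(1) covector_det_def index_lists_length intro!: sum.neutral)
qed

section \<open>Orthonormal frames\<close>

lemma inner_product_onD:
  assumes "inner_product_on UNIV g"
  shows "g x y = g y x" and "linear (g x)" and "linear (\<lambda>x. g x y)" and "x \<noteq> 0 \<Longrightarrow> g x x > 0"
  using assms unfolding inner_product_on_def linear_iff by (metis UNIV_I real_scaleR_def)+

lemma sum_fun_apply: "(\<Sum>i\<in>A. f i) x = (\<Sum>i\<in>A. f i x)"
  by (induction A rule: infinite_finite_induct) auto

text \<open>Invariance of the determinant under transposition: each permutation is replaced by its
  inverse. Frame indices and arguments can thus change places.\<close>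

lemma covector_det_gram_commute:
  assumes sym: "\<And>x y. g x y = g y x"
  shows "covector_det (map g xs) ys = covector_det (map g ys) xs"
proof (cases "length xs = length ys")
  case len: True
  let ?P = "{\<sigma>. \<sigma> permutes {..<length ys}}"
  have "covector_det (map g xs) ys =
      (\<Sum>\<sigma>\<in>?P. of_int (sign \<sigma>) * tensor_eval (map g xs) (permute_list \<sigma> ys))"
    using len by (simp add: covector_det_def)
  also have "\<dots> = (\<Sum>\<sigma>\<in>?P. of_int (sign (inv \<sigma>)) * tensor_eval (map g xs) (permute_list (inv \<sigma>) ys))"
    by (rule sum_permutations_inverse)
  also have "\<dots> = (\<Sum>\<sigma>\<in>?P. of_int (sign \<sigma>) * tensor_eval (map g ys) (permute_list \<sigma> xs))"
  proof (rule sum.cong[OF refl])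
    fix \<sigma> assume "\<sigma> \<in> ?P"
    then have \<sigma>: "\<sigma> permutes {..<length ys}" by simp
    then have perm: "permutation \<sigma>" by (meson finite_lessThan permutes_imp_permutation)
    have "tensor_eval (map g xs) (permute_list (inv \<sigma>) ys) =
        (\<Prod>i<length ys. g (xs ! i) (ys ! inv \<sigma> i))"
      unfolding tensor_eval_def using len permutes_inv[OF \<sigma>]
      by (auto simp: permute_list_nth intro!: prod.cong)
    also have "\<dots> = (\<Prod>i<length ys. g (xs ! \<sigma> i) (ys ! i))"
      using prod.permute[OF \<sigma>, of "\<lambda>i. g (xs ! i) (ys ! inv \<sigma> i)"] permutes_inverses[OF \<sigma>]
      by (simp add: o_def)
    also have "\<dots> = tensor_eval (map g ys) (permute_list \<sigma> xs)"
      unfolding tensor_eval_def using len \<sigma> sym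
      by (auto simp: permute_list_nth intro!: prod.cong)
    finally show "of_int (sign (inv \<sigma>)) * tensor_eval (map g xs) (permute_list (inv \<sigma>) ys) =
        of_int (sign \<sigma>) * tensor_eval (map g ys) (permute_list \<sigma> xs)"
      by (simp add: sign_inverse[OF perm])
  qed
  finally show ?thesis using len by (simp add: covector_det_def)
qed (simp add: covector_det_def)

text \<open>The context itself serves as the fixed reference frame; moving frames of other metrics
  appear inside it as further instances, through qualified names.\<close>

locale orthonormal_frame =
  fixes g :: "'a::real_vector \<Rightarrow> 'a \<Rightarrow> real" and n :: nat and e :: "nat \<Rightarrow> 'a"
  assumes inner: "inner_product_on UNIV g"
    and basis: "orthonormal_basis UNIV g {..<n} e"
begin

text \<open>For indices below \<open>n\<close>, \<open>g (e a)\<close> is the covector dual to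
  \<open>e a\<close>, so this is the wedge of dual covectors along \<open>L\<close>, available also
  for unsorted and repeating lists.\<close>

abbreviation eps :: "nat list \<Rightarrow> 'a form"
  where "eps L \<equiv> covector_det (map (\<lambda>a. g (e a)) L)"

lemmas g_commute = inner_product_onD(1)[OF inner]
  and linear_g = inner_product_onD(2)[OF inner]

lemma g_basis: "\<lbrakk>i < n; j < n\<rbrakk> \<Longrightarrow> g (e i) (e j) = (if i = j then 1 else 0)"
  using basis by (simp add: orthonormal_basis_def)

lemma coordinates: "v = (\<Sum>a<n. g (e a) v *\<^sub>R e a)"
proof -
  have "v \<in> span (e ` {..<n})" using basis by (simp add: orthonormal_basis_def)
  then show ?thesis
  proof (induction rule: span_induct)
    case base
    have "c *\<^sub>R (\<Sum>a<n. g (e a) x *\<^sub>R e a) = (\<Sum>a<n. g (e a) (c *\<^sub>R x) *\<^sub>R e a)" for c x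
      by (simp add: linear_scale[OF linear_g] scaleR_sum_right)
    then show ?case
      unfolding subspace_def mem_Collect_eq
      by (intro conjI ballI allI)
        (simp_all add: linear_0[OF linear_g] linear_add[OF linear_g] scaleR_add_left sum.distrib,
          metis)
  next
    case (step x)
    then obtain b where "b < n" "x = e b" by auto
    then show ?case by (simp add: g_basis if_distrib[of "\<lambda>c. c *\<^sub>R _"] cong: if_cong)
  qed
qed

lemma inj_on_frame: "inj_on e {..<n}"
proof (rule inj_onI)
  fix i j assume "i \<in> {..<n}" "j \<in> {..<n}" "e i = e j"
  then show "i = j" using g_basis[of i j] g_basis[of i i] by (auto split: if_splits)
qed

lemma independent_frame: "independent (e ` {..<n})"
proof
  assume "dependent (e ` {..<n})"
  then obtain u i where u: "i < n" "u (e i) \<noteq> 0" "(\<Sum>v\<in>e ` {..<n}. u v *\<^sub>R v) = 0"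
    by (auto simp: dependent_finite)
  then have "0 = g (e i) (\<Sum>j<n. u (e j) *\<^sub>R e j)"
    by (simp add: sum.reindex[OF inj_on_frame] linear_0[OF linear_g])
  also have "\<dots> = (\<Sum>j<n. u (e j) * g (e i) (e j))"
    by (simp add: linear_sum[OF linear_g] linear_scale[OF linear_g])
  also have "\<dots> = u (e i)" using u(1) by (simp add: g_basis if_distrib cong: if_cong)
  finally show False using u(2) by simp
qed

text \<open>\<open>dual_basis\<close> is defined by \<open>representation\<close>, without a metric;
  uniqueness of representations in an independent set identifies it with the pairing against a frame
  vector.\<close>

lemma dual_basis_eq:
  assumes "i < n"
  shows "dual_basis n e i = g (e i)"
proof
  fix v
  let ?f = "\<lambda>b. if b \<in> e ` {..<n} then g b v else 0"
  have "representation (e ` {..<n}) v = ?f"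
  proof (rule representation_eqI[OF independent_frame])
    show "v \<in> span (e ` {..<n})" using basis by (simp add: orthonormal_basis_def)
    show "b \<in> e ` {..<n}" if "?f b \<noteq> 0" for b using that by (auto split: if_splits)
    show "finite {b. ?f b \<noteq> 0}" by (rule finite_subset[of _ "e ` {..<n}"]) auto
    have "(\<Sum>b | ?f b \<noteq> 0. ?f b *\<^sub>R b) = (\<Sum>b\<in>e ` {..<n}. ?f b *\<^sub>R b)"
      by (rule sum.mono_neutral_left) auto
    also have "\<dots> = v"
      using coordinates[of v] by (simp add: sum.reindex[OF inj_on_frame])
    finally show "(\<Sum>b | ?f b \<noteq> 0. ?f b *\<^sub>R b) = v" .
  qed
  then show "dual_basis n e i v = g (e i) v" using assms by (simp add: dual_basis_def)
qed

lemma basis_form_eq: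
  assumes "set L \<subseteq> {..<n}"
  shows "basis_form n e L = eps L"
proof -
  have "map (dual_basis n e) L = map (\<lambda>a. g (e a)) L"
    using assms by (auto simp: dual_basis_eq)
  then show ?thesis by (simp only: basis_form_def wedge_covectors_eq_det)
qed

lemma eps_in_forms: "length L = p \<Longrightarrow> eps L \<in> forms p"
  using covector_det_in_forms[of "map (\<lambda>a. g (e a)) L"] linear_g by auto

lemma eps_commute: "eps L (map e M) = eps M (map e L)"
  using covector_det_gram_commute[of g "map e L" "map e M"] g_commute by (simp add: o_def)

lemma expansion:
  assumes "\<alpha> \<in> forms p"
  shows "\<alpha> xs = (\<Sum>L\<in>index_lists n p. \<alpha> (map e L) * eps L xs) / fact p"
  by (rule forms_expansion[OF assms coordinates])

text \<open>A reproducing property: it is \<open>expansion\<close> with index and argument exchanged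
  by \<open>eps_commute\<close>. It evaluates the contractions with powers of the metric.\<close>

lemma sum_eps:
  assumes "\<alpha> \<in> forms p"
  shows "(\<Sum>L\<in>index_lists n p. \<alpha> (map e L) * eps N (map e L)) = fact p * \<alpha> (map e N)"
  using expansion[OF assms, of "map e N"] by (simp add: eps_commute[of N])

text \<open>The Leibniz term of \<sigma> is nonzero only if permuting \<open>J\<close> by \<sigma>
  yields \<open>I\<close>. Then both have the same underlying set, so as increasing lists they
  coincide, and distinctness of the entries forces \<sigma> to be the identity.\<close>

lemma eps_increasing:
  assumes "I \<in> increasing_indices n p" "J \<in> increasing_indices n p"
  shows "eps I (map e J) = (if I = J then 1 else 0)"
proof -
  have I: "length I = p" "sorted I" "distinct I" "set I \<subseteq> {..<n}"
    and J: "length J = p" "sorted J" "distinct J" "set J \<subseteq> {..<n}"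
    using assms by (auto simp: increasing_indices_def strict_sorted_iff)
  have val: "tensor_eval (map (\<lambda>a. g (e a)) I) (permute_list \<sigma> (map e J)) =
      (if I = permute_list \<sigma> J then 1 else 0)" if \<sigma>: "\<sigma> permutes {..<p}" for \<sigma>
  proof -
    have in_J: "J ! \<sigma> i < n" if "i < p" for i
      using permutes_in_image[OF \<sigma>, of i] J that by (metis lessThan_iff nth_mem subset_iff)
    have "tensor_eval (map (\<lambda>a. g (e a)) I) (permute_list \<sigma> (map e J)) =
        (\<Prod>i<p. if I ! i = J ! \<sigma> i then 1 else 0)"
      unfolding tensor_eval_def
    proof (rule prod.cong)
      fix i assume "i \<in> {..<p}"
      then have i: "i < p" by simp
      then have "I ! i < n" "\<sigma> i < p"
        using I permutes_in_image[OF \<sigma>, of i] by (auto simp: subset_iff)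
      then show "(map (\<lambda>a. g (e a)) I ! i) (permute_list \<sigma> (map e J) ! i) =
          (if I ! i = J ! \<sigma> i then 1 else 0)"
        using i I J \<sigma> in_J[OF i] by (simp add: permute_list_nth g_basis)
    qed (simp add: I)
    also have "\<dots> = (if \<forall>i<p. I ! i = J ! \<sigma> i then 1 else 0)"
      by (auto simp: prod_zero_iff)
    also have "(\<forall>i<p. I ! i = J ! \<sigma> i) \<longleftrightarrow> I = permute_list \<sigma> J"
      using I J \<sigma> by (auto simp: list_eq_iff_nth_eq permute_list_nth)
    finally show ?thesis .
  qed
  have det: "eps I (map e J) = (\<Sum>\<sigma> | \<sigma> permutes {..<p}. of_int (sign \<sigma>) *
      (if I = permute_list \<sigma> J then 1 else 0))"
    using I J by (simp add: covector_det_def val)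
  show ?thesis
  proof (cases "I = J")
    case True
    have "\<sigma> = id" if "\<sigma> permutes {..<p}" "I = permute_list \<sigma> J" for \<sigma>
    proof
      fix i show "\<sigma> i = id i"
      proof (cases "i < p")
        case i: True
        then have "\<sigma> i < p" using permutes_in_image[OF that(1), of i] by simp
        moreover have "permute_list \<sigma> J ! i = J ! \<sigma> i"
          using that(1) J i by (simp add: permute_list_nth)
        then have "J ! i = J ! \<sigma> i" using that(2) True by metis
        ultimately show ?thesis using J i by (simp add: nth_eq_iff_index_eq)
      qed (simp add: permutes_not_in[OF that(1)])
    qed
    then have "eps I (map e J) = (\<Sum>\<sigma>\<in>{id}. of_int (sign \<sigma>) *
        (if I = permute_list \<sigma> J then 1 else 0))"
      unfolding det by (intro sum.mono_neutral_right) (auto simp: finite_permutations permutes_id)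
    then show ?thesis using True by simp
  next
    case False
    have "I \<noteq> permute_list \<sigma> J" if "\<sigma> permutes {..<p}" for \<sigma>
    proof
      assume "I = permute_list \<sigma> J"
      then have "set I = set J" using that J by simp
      then show False using False I J by (metis sorted_distinct_set_unique)
    qed
    then show ?thesis using False by (simp add: det)
  qed
qed

section \<open>Double forms in a frame, and their inner product\<close>

definition separately_forms :: "nat \<Rightarrow> nat \<Rightarrow> 'a dform set"
  where "separately_forms p q = {\<omega>. (\<forall>ys. (\<lambda>xs. \<omega> xs ys) \<in> forms p) \<and> (\<forall>xs. \<omega> xs \<in> forms q)}"

lemma separate_expansion_increasing:
  assumes "\<omega> \<in> separately_forms p q"
  shows "\<omega> = (\<Sum>(I, J)\<in>increasing_indices n p \<times> increasing_indices n q.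
    \<omega> (map e I) (map e J) *\<^sub>R tensor (basis_form n e I) (basis_form n e J))"
proof (intro ext)
  fix xs ys
  have inc: "\<alpha> zs = (\<Sum>I\<in>increasing_indices n r. \<alpha> (map e I) * eps I zs)"
    if \<alpha>: "\<alpha> \<in> forms r" for \<alpha> r zs
  proof -
    have "(\<Sum>L\<in>index_lists n r. \<alpha> (map e L) * eps L zs) =
        fact r * (\<Sum>I\<in>increasing_indices n r. \<alpha> (map e I) * eps I zs)"
    proof (rule sum_index_lists_symmetric)
      fix L assume "L \<in> index_lists n r" "\<not> distinct L"
      then show "\<alpha> (map e L) * eps L zs = 0"
        using formsD(3)[OF \<alpha>, of "map e L"] by (simp add: distinct_map)
    next
      \<comment> \<open>Coefficient and basis form both pick up the sign of \<sigma>, so their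
        product is symmetric in the index list.\<close>
      fix L \<sigma> assume L: "L \<in> index_lists n r" and \<sigma>: "\<sigma> permutes {..<r}"
      have len: "length L = r" using L by (rule index_lists_length)
      \<comment> \<open>\<open>covector_det_permute\<close> permutes arguments, but here the
        covectors are permuted; transposition exchanges the two roles and is undone
        afterwards.\<close>
      have "eps (permute_list \<sigma> L) zs = covector_det (map g (permute_list \<sigma> (map e L))) zs"
        using \<sigma> len by (simp add: permute_list_map o_def)
      also have "\<dots> = covector_det (map g zs) (permute_list \<sigma> (map e L))"
        by (rule covector_det_gram_commute[of g, OF g_commute])
      also have "\<dots> = of_int (sign \<sigma>) * covector_det (map g zs) (map e L)"
        using \<sigma> len by (simp add: covector_det_permute)
      also have "covector_det (map g zs) (map e L) = covector_det (map g (map e L)) zs"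
        by (rule covector_det_gram_commute[of g, OF g_commute])
      finally have "eps (permute_list \<sigma> L) zs = of_int (sign \<sigma>) * eps L zs" by (simp add: o_def)
      moreover have "\<alpha> (map e (permute_list \<sigma> L)) = of_int (sign \<sigma>) * \<alpha> (map e L)"
        using forms_permute[OF \<alpha>, of "map e L" \<sigma>] \<sigma> len by (simp add: permute_list_map)
      moreover have "of_int (sign \<sigma>) * of_int (sign \<sigma>) = (1::real)"
        by (metis of_int_1 of_int_mult sign_idempotent)
      ultimately show "\<alpha> (map e (permute_list \<sigma> L)) * eps (permute_list \<sigma> L) zs =
          \<alpha> (map e L) * eps L zs"
        by (simp add: algebra_simps)
    qed
    then show ?thesis using expansion[OF \<alpha>, of zs] by simp
  qed
  have 1: "(\<lambda>xs. \<omega> xs ys) \<in> forms p" and 2: "\<omega> xs \<in> forms q" for xs ys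
    using assms by (auto simp: separately_forms_def)
  have "\<omega> xs ys = (\<Sum>I\<in>increasing_indices n p. \<omega> (map e I) ys * eps I xs)"
    by (rule inc[OF 1])
  also have "\<dots> = (\<Sum>I\<in>increasing_indices n p. \<Sum>J\<in>increasing_indices n q.
      \<omega> (map e I) (map e J) * eps I xs * eps J ys)"
    by (subst inc[OF 2]) (simp add: sum_distrib_right sum_distrib_left algebra_simps)
  also have "\<dots> = (\<Sum>(I, J)\<in>increasing_indices n p \<times> increasing_indices n q.
      \<omega> (map e I) (map e J) * eps I xs * eps J ys)"
    by (simp add: sum.cartesian_product)
  also have "\<dots> = (\<Sum>(I, J)\<in>increasing_indices n p \<times> increasing_indices n q.
      \<omega> (map e I) (map e J) *\<^sub>R tensor (basis_form n e I) (basis_form n e J)) xs ys"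
    unfolding sum_fun_apply
    by (rule sum.cong) (auto simp: basis_form_eq increasing_indices_def tensor_def)
  finally show "\<omega> xs ys = (\<Sum>(I, J)\<in>increasing_indices n p \<times> increasing_indices n q.
      \<omega> (map e I) (map e J) *\<^sub>R tensor (basis_form n e I) (basis_form n e J)) xs ys" .
qed

lemma tensor_in_double_forms:
  "\<lbrakk>\<alpha> \<in> forms p; \<beta> \<in> forms q\<rbrakk> \<Longrightarrow> tensor \<alpha> \<beta> \<in> double_forms p q"
  unfolding double_forms_def by (intro span_base) auto

lemma basis_form_in_forms: "I \<in> increasing_indices n p \<Longrightarrow> basis_form n e I \<in> forms p"
  by (simp add: basis_form_eq eps_in_forms increasing_indices_def)

text \<open>The slicewise description is a subspace containing all pure tensors; conversely the
  frame expansion is a finite sum of pure tensors. Membership in the span can afterwards be checked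
  in each argument separately.\<close>

lemma double_forms_eq: "double_forms p q = separately_forms p q"
proof (intro set_eqI iffI)
  fix \<omega> :: "'a dform" assume "\<omega> \<in> double_forms p q"
  then show "\<omega> \<in> separately_forms p q"
    unfolding double_forms_def
  proof (induction rule: span_induct)
    case base
    have "subspace (separately_forms p q)"
      using subspace_0[OF subspace_forms] subspace_add[OF subspace_forms]
        subspace_scale[OF subspace_forms]
      unfolding subspace_def separately_forms_def zero_fun_def plus_fun_def scaleR_fun_def
      by (simp, blast)
    then show ?case by simp
  next
    case (step \<omega>)
    then obtain \<alpha> \<beta> where \<omega>: "\<omega> = tensor \<alpha> \<beta>" "\<alpha> \<in> forms p" "\<beta> \<in> forms q" by auto
    have "(\<lambda>xs. \<alpha> xs * c) \<in> forms p" "(\<lambda>ys. c * \<beta> ys) \<in> forms q" for c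
      using subspace_scale[OF subspace_forms \<omega>(2), of c]
        subspace_scale[OF subspace_forms \<omega>(3), of c]
      by (simp_all add: scaleR_fun_def mult.commute)
    then show ?case by (simp add: \<omega>(1) separately_forms_def tensor_def)
  qed
next
  fix \<omega> :: "'a dform" assume "\<omega> \<in> separately_forms p q"
  then have "\<omega> = (\<Sum>(I, J)\<in>increasing_indices n p \<times> increasing_indices n q.
    \<omega> (map e I) (map e J) *\<^sub>R tensor (basis_form n e I) (basis_form n e J))"
    by (rule separate_expansion_increasing)
  also have "\<dots> \<in> double_forms p q"
    by (auto simp: double_forms_def basis_form_in_forms
        intro!: span_sum span_scale tensor_in_double_forms[unfolded double_forms_def])
  finally show "\<omega> \<in> double_forms p q" .
qed

lemma double_formsD:
  fixes \<omega> :: "'a dform"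
  assumes "\<omega> \<in> double_forms p q"
  shows "(\<lambda>xs. \<omega> xs ys) \<in> forms p" and "\<omega> xs \<in> forms q"
  using assms by (auto simp: double_forms_eq separately_forms_def)

lemma double_formsI:
  fixes \<omega> :: "'a dform"
  assumes "\<And>ys. (\<lambda>xs. \<omega> xs ys) \<in> forms p" and "\<And>xs. \<omega> xs \<in> forms q"
  shows "\<omega> \<in> double_forms p q"
  using assms by (auto simp: double_forms_eq separately_forms_def)

text \<open>The lists are not sorted, so every pair of index sets is counted \<open>p! q!\<close>
  times, which the denominator removes. In this form a change of frame is plain
  multilinearity.\<close>

definition frame_inner :: "nat \<Rightarrow> nat \<Rightarrow> 'a dform \<Rightarrow> 'a dform \<Rightarrow> real"
  where "frame_inner p q \<omega> \<eta> =
    (\<Sum>L\<in>index_lists n p. \<Sum>M\<in>index_lists n q.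
      \<omega> (map e L) (map e M) * \<eta> (map e L) (map e M)) / (fact p * fact q)"

lemma sum_forms_symmetric:
  assumes "\<alpha> \<in> forms p" "\<beta> \<in> forms p"
  shows "(\<Sum>L\<in>index_lists n p. \<alpha> (map e L) * \<beta> (map e L)) =
    fact p * (\<Sum>I\<in>increasing_indices n p. \<alpha> (map e I) * \<beta> (map e I))"
proof (rule sum_index_lists_symmetric)
  fix L assume "L \<in> index_lists n p" "\<not> distinct L"
  then show "\<alpha> (map e L) * \<beta> (map e L) = 0"
    using formsD(3)[OF assms(1), of "map e L"] by (simp add: distinct_map)
next
  fix L \<sigma> assume L: "L \<in> index_lists n p" and \<sigma>: "\<sigma> permutes {..<p}"
  have "of_int (sign \<sigma>) * of_int (sign \<sigma>) = (1::real)"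
    by (metis of_int_1 of_int_mult sign_idempotent)
  then show "\<alpha> (map e (permute_list \<sigma> L)) * \<beta> (map e (permute_list \<sigma> L)) =
      \<alpha> (map e L) * \<beta> (map e L)"
    using assms[THEN forms_permute, of "map e L" \<sigma>] \<sigma> index_lists_length[OF L]
    by (simp add: permute_list_map algebra_simps)
qed

lemma frame_inner_increasing:
  assumes "\<omega> \<in> double_forms p q" "\<eta> \<in> double_forms p q"
  shows "frame_inner p q \<omega> \<eta> = (\<Sum>(I, J)\<in>increasing_indices n p \<times> increasing_indices n q.
    \<omega> (map e I) (map e J) * \<eta> (map e I) (map e J))"
proof -
  have "frame_inner p q \<omega> \<eta> = (\<Sum>L\<in>index_lists n p. \<Sum>J\<in>increasing_indices n q.
      \<omega> (map e L) (map e J) * \<eta> (map e L) (map e J)) / fact p"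
    unfolding frame_inner_def
    by (subst sum_forms_symmetric[OF double_formsD(2)[OF assms(1)] double_formsD(2)[OF assms(2)]])
      (simp flip: sum_distrib_left)
  also have "\<dots> = (\<Sum>J\<in>increasing_indices n q. \<Sum>I\<in>increasing_indices n p.
      \<omega> (map e I) (map e J) * \<eta> (map e I) (map e J))"
    by (subst sum.swap,
        subst sum_forms_symmetric[OF double_formsD(1)[OF assms(1)] double_formsD(1)[OF assms(2)]])
      (simp flip: sum_distrib_left)
  also have "\<dots> = (\<Sum>(I, J)\<in>increasing_indices n p \<times> increasing_indices n q.
      \<omega> (map e I) (map e J) * \<eta> (map e I) (map e J))"
    by (subst sum.swap) (simp add: sum.cartesian_product)
  finally show ?thesis .
qed

text \<open>Definiteness is the only point: by the expansion, a nonzero double form has a nonzero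
  component at some pair of increasing lists, and over such pairs the value is a sum of
  squares.\<close>

lemma inner_product_frame_inner:
  "inner_product_on (double_forms p q) (frame_inner p q)"
  unfolding inner_product_on_def
proof (intro conjI ballI allI impI)
  fix \<omega> :: "'a dform" assume \<omega>: "\<omega> \<in> double_forms p q" and "\<omega> \<noteq> 0"
  let ?S = "increasing_indices n p \<times> increasing_indices n q"
  have "\<not> (\<forall>(I, J)\<in>?S. \<omega> (map e I) (map e J) = 0)"
  proof
    assume "\<forall>(I, J)\<in>?S. \<omega> (map e I) (map e J) = 0"
    then have "(\<Sum>(I, J)\<in>?S.
        \<omega> (map e I) (map e J) *\<^sub>R tensor (basis_form n e I) (basis_form n e J)) = 0"
      by (intro sum.neutral) auto
    then show False
      using separate_expansion_increasing[of \<omega> p q] \<omega> \<open>\<omega> \<noteq> 0\<close> by (simp add: double_forms_eq)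
  qed
  then obtain I J where "(I, J) \<in> ?S" "\<omega> (map e I) (map e J) \<noteq> 0" by auto
  then have "0 < (\<Sum>(I, J)\<in>?S. \<omega> (map e I) (map e J) * \<omega> (map e I) (map e J))"
    by (intro sum_pos2[of _ "(I, J)"]) (auto simp: zero_less_mult_iff linorder_neq_iff)
  then show "0 < frame_inner p q \<omega> \<omega>" by (simp add: frame_inner_increasing[OF \<omega> \<omega>])
qed (auto simp: frame_inner_def algebra_simps sum.distrib add_divide_distrib sum_distrib_left)

lemma orthonormal_tensors:
  "orthonormal_basis (double_forms p q) (frame_inner p q)
    (increasing_indices n p \<times> increasing_indices n q)
    (\<lambda>(is, js). tensor (basis_form n e is) (basis_form n e js))"
  (is "orthonormal_basis _ _ ?S ?b")
  unfolding orthonormal_basis_def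
proof (intro conjI ballI)
  have val: "tensor (basis_form n e I) (basis_form n e J) (map e K) (map e L) =
      (if I = K \<and> J = L then 1 else 0)"
    if "(I, J) \<in> ?S" "(K, L) \<in> ?S" for I J K L
  proof -
    have "basis_form n e I = eps I" "basis_form n e J = eps J"
      using that by (auto simp: increasing_indices_def intro!: basis_form_eq)
    then show ?thesis using that eps_increasing by (auto simp: tensor_def)
  qed
  fix x y assume x: "x \<in> ?S" and y: "y \<in> ?S"
  obtain I J K L where xy: "x = (I, J)" "y = (K, L)" by fastforce
  have mem: "?b x \<in> double_forms p q" "?b y \<in> double_forms p q"
    using x y by (auto simp: basis_form_in_forms intro!: tensor_in_double_forms)
  have "frame_inner p q (?b x) (?b y) = (\<Sum>z\<in>?S. if z = x then (if x = y then 1 else 0) else 0)"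
    unfolding frame_inner_increasing[OF mem]
    by (rule sum.cong) (use x y xy in \<open>auto simp: val split: if_splits\<close>)
  also have "\<dots> = (if x = y then 1 else 0)" using x by simp
  finally show "frame_inner p q (?b x) (?b y) = (if x = y then 1 else 0)" .
next
  show "span (?b ` ?S) = double_forms p q"
  proof
    have "?b ` ?S \<subseteq> double_forms p q"
      by (auto simp: basis_form_in_forms intro!: tensor_in_double_forms)
    then show "span (?b ` ?S) \<subseteq> double_forms p q"
      unfolding double_forms_def by (simp add: span_minimal)
    show "double_forms p q \<subseteq> span (?b ` ?S)"
    proof
      fix \<omega> :: "'a dform" assume "\<omega> \<in> double_forms p q"
      then have "\<omega> = (\<Sum>(I, J)\<in>?S. \<omega> (map e I) (map e J) *\<^sub>R ?b (I, J))"
        using separate_expansion_increasing[of \<omega> p q] by (simp add: double_forms_eq)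
      also have "\<dots> \<in> span (?b ` ?S)"
      proof (rule span_sum)
        fix z assume "z \<in> ?S"
        then have "(case z of (I, J) \<Rightarrow> \<omega> (map e I) (map e J)) *\<^sub>R ?b z \<in> span (?b ` ?S)"
          by (intro span_scale span_base imageI)
        then show "(case z of (I, J) \<Rightarrow> \<omega> (map e I) (map e J) *\<^sub>R ?b (I, J)) \<in> span (?b ` ?S)"
          by (cases z) simp
      qed
      finally show "\<omega> \<in> span (?b ` ?S)" .
    qed
  qed
qed

text \<open>Bilinearity and symmetry determine \<open>G\<close> from its values on the spanning
  orthonormal tensors. Since \<open>G\<close> obeys these laws only on
  \<open>double_forms p q\<close>, every partial sum is kept inside that space.\<close>

lemma frame_inner_unique:
  assumes G: "inner_product_on (double_forms p q) G"
    and ON: "orthonormal_basis (double_forms p q) G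
      (increasing_indices n p \<times> increasing_indices n q)
      (\<lambda>(is, js). tensor (basis_form n e is) (basis_form n e js))"
      (is "orthonormal_basis _ _ ?S ?b")
    and \<omega>: "\<omega> \<in> double_forms p q" and \<eta>: "\<eta> \<in> double_forms p q"
  shows "G \<omega> \<eta> = frame_inner p q \<omega> \<eta>"
proof -
  let ?D = "double_forms p q :: 'a dform set"
  let ?c = "\<lambda>\<omega>::'a dform. \<lambda>z. \<omega> (map e (fst z)) (map e (snd z))"
  have sub: "subspace ?D" unfolding double_forms_def by (rule subspace_span)
  have b: "?b z \<in> ?D" if "z \<in> ?S" for z
    using that by (auto simp: basis_form_in_forms intro!: tensor_in_double_forms)
  have sum_in: "(\<Sum>z\<in>T. c z *\<^sub>R ?b z) \<in> ?D" if "T \<subseteq> ?S" for c T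
    using that b by (intro subspace_sum[OF sub] subspace_scale[OF sub]) auto
  have G_sym: "G x y = G y x" if "x \<in> ?D" "y \<in> ?D" for x y
    using G that by (simp add: inner_product_on_def)
  have G_add: "G (x + y) z = G x z + G y z" if "x \<in> ?D" "y \<in> ?D" "z \<in> ?D" for x y z
    using G that by (simp add: inner_product_on_def)
  have G_scale: "G (c *\<^sub>R x) y = c * G x y" if "x \<in> ?D" "y \<in> ?D" for c x y
    using G that by (simp add: inner_product_on_def)
  have G_sum: "G (\<Sum>z\<in>T. c z *\<^sub>R ?b z) y = (\<Sum>z\<in>T. c z * G (?b z) y)"
    if "T \<subseteq> ?S" and y: "y \<in> ?D" for c T y
  proof -
    have "finite T" by (rule finite_subset[OF that(1)]) simp
    then show ?thesis using that(1)
    proof (induction T rule: finite_induct)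
      case empty
      show ?case using G_scale[OF y y, of 0] by (simp only: sum.empty scaleR_zero_left mult_zero_left)
    next
      case (insert z T)
      then have z: "?b z \<in> ?D" and "(\<Sum>z\<in>T. c z *\<^sub>R ?b z) \<in> ?D"
        using b sum_in by auto
      then have "G (c z *\<^sub>R ?b z + (\<Sum>z\<in>T. c z *\<^sub>R ?b z)) y =
          c z * G (?b z) y + G (\<Sum>z\<in>T. c z *\<^sub>R ?b z) y"
        using G_add[OF subspace_scale[OF sub z, of "c z"] _ y] G_scale[OF z y] by simp
      then show ?case
        using insert.IH insert.prems by (simp only: sum.insert[OF insert.hyps(1,2)] insert_subset)
    qed
  qed
  have exp: "\<omega> = (\<Sum>z\<in>?S. ?c \<omega> z *\<^sub>R ?b z)" if "\<omega> \<in> ?D" for \<omega>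
    using separate_expansion_increasing[of \<omega> p q] that by (simp add: double_forms_eq case_prod_beta)
  have "G \<omega> \<eta> = (\<Sum>z\<in>?S. ?c \<omega> z * G (?b z) \<eta>)"
    using G_sum[OF subset_refl \<eta>, of "?c \<omega>"] exp[OF \<omega>] by simp
  also have "\<dots> = (\<Sum>z\<in>?S. ?c \<omega> z * ?c \<eta> z)"
  proof (rule sum.cong[OF refl])
    fix z assume z: "z \<in> ?S"
    have "G (?b z) \<eta> = G \<eta> (?b z)" by (rule G_sym[OF b[OF z] \<eta>])
    also have "\<dots> = (\<Sum>w\<in>?S. ?c \<eta> w * G (?b w) (?b z))"
      using G_sum[OF subset_refl b[OF z], of "?c \<eta>"] exp[OF \<eta>] by simp
    also have "\<dots> = (\<Sum>w\<in>?S. if w = z then ?c \<eta> w else 0)"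
    proof (rule sum.cong[OF refl])
      fix w assume "w \<in> ?S"
      then have "G (?b w) (?b z) = (if w = z then 1 else 0)"
        using ON z unfolding orthonormal_basis_def by blast
      then show "?c \<eta> w * G (?b w) (?b z) = (if w = z then ?c \<eta> w else 0)"
        by (simp only: mult_1_right mult_zero_right split: if_split) simp
    qed
    also have "\<dots> = ?c \<eta> z" using z by simp
    finally show "?c \<omega> z * G (?b z) \<eta> = ?c \<omega> z * ?c \<eta> z" by simp
  qed
  also have "\<dots> = frame_inner p q \<omega> \<eta>"
    by (simp add: frame_inner_increasing[OF \<omega> \<eta>] case_prod_beta)
  finally show ?thesis .
qed

end

section \<open>Gram-Schmidt, and the inner product obtained by choice\<close>

lemma gram_schmidt:
  fixes g :: "'a::real_vector \<Rightarrow> 'a \<Rightarrow> real"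
  assumes g: "inner_product_on UNIV g" and "finite B"
  shows "\<exists>n e. (\<forall>i<n. \<forall>j<n. g (e i) (e j) = (if i = j then 1 else 0)) \<and> span (e ` {..<n::nat}) = span B"
  using \<open>finite B\<close>
proof (induction B rule: finite_induct)
  case empty
  show ?case by (rule exI[of _ 0]) auto
next
  case (insert b B)
  note lin = inner_product_onD(2)[OF g] and sym = inner_product_onD(1)[OF g]
  obtain n :: nat and e where e: "\<And>i j. \<lbrakk>i < n; j < n\<rbrakk> \<Longrightarrow> g (e i) (e j) = (if i = j then 1 else 0)"
    and sp: "span (e ` {..<n}) = span B"
    using insert.IH by blast
  define u where "u = b - (\<Sum>i<n. g (e i) b *\<^sub>R e i)"
  have proj: "(\<Sum>i<n. g (e i) b *\<^sub>R e i) \<in> span B"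
    unfolding sp[symmetric] by (rule span_sum, rule span_scale, rule span_base) simp
  show ?case
  proof (cases "u = 0")
    \<comment> \<open>A vector with vanishing remainder adds nothing to the span and is dropped, so
      \<open>n\<close> may stay below the size of \<open>B\<close>.\<close>
    case True
    then have "b \<in> span B" using proj by (simp add: u_def)
    then show ?thesis using e sp by (intro exI[of _ n] exI[of _ e]) (simp add: span_redundant)
  next
    case False
    then have pos: "g u u > 0" by (rule inner_product_onD(4)[OF g])
    have orth: "g (e j) u = 0" "g u (e j) = 0" if "j < n" for j
    proof -
      have "g (e j) u = g (e j) b - (\<Sum>i<n. g (e i) b * g (e j) (e i))"
        by (simp add: u_def linear_diff[OF lin] linear_sum[OF lin] linear_scale[OF lin])
      also have "(\<Sum>i<n. g (e i) b * g (e j) (e i)) = g (e j) b"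
        using that by (simp add: e if_distrib cong: if_cong)
      finally show "g (e j) u = 0" by simp
      then show "g u (e j) = 0" by (simp only: sym[of u])
    qed
    define c where "c = 1 / sqrt (g u u)"
    have c: "c \<noteq> 0" "c * c * g u u = 1" using pos by (auto simp: c_def)
    define e' where "e' = e(n := c *\<^sub>R u)"
    have scl: "g (c *\<^sub>R x) y = c * g x y" "g x (c *\<^sub>R y) = c * g x y" for x y
      using linear_scale[OF lin[of x], of c y] linear_scale[OF inner_product_onD(3)[OF g, of y], of c x]
      by auto
    have "g (e' i) (e' j) = (if i = j then 1 else 0)" if "i < Suc n" "j < Suc n" for i j
      using that e orth c by (auto simp: e'_def less_Suc_eq scl)
    moreover have "span (e' ` {..<Suc n}) = span (insert b B)"
    proof -
      have "e' ` {..<Suc n} = insert (c *\<^sub>R u) (e ` {..<n})"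
        by (auto simp: e'_def lessThan_Suc)
      also have "span \<dots> = span (insert (c *\<^sub>R u) B)"
        by (simp add: span_insert sp)
      also have "\<dots> = span (insert u B)"
      proof -
        have "(1 / c) *\<^sub>R (c *\<^sub>R u) \<in> span (insert (c *\<^sub>R u) B)"
          by (intro span_scale span_base) simp
        then have "u \<in> span (insert (c *\<^sub>R u) B)" using c by simp
        moreover have "c *\<^sub>R u \<in> span (insert u B)" by (intro span_scale span_base) simp
        ultimately show ?thesis unfolding span_eq by (auto intro: span_base)
      qed
      also have "\<dots> = span (insert b B)"
        by (rule eq_span_insert_eq) (use span_neg[OF proj] in \<open>simp add: u_def\<close>)
      finally show ?thesis .
    qed
    ultimately show ?thesis by blast
  qed
qed

lemma exists_orthonormal_frame:
  fixes g :: "'a::real_vector \<Rightarrow> 'a \<Rightarrow> real" and B :: "'a set"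
  assumes "inner_product_on UNIV g" and "finite B" "span B = UNIV"
  obtains n e where "orthonormal_frame g n e"
proof -
  obtain n :: nat and e where "\<forall>i<n. \<forall>j<n. g (e i) (e j) = (if i = j then 1 else 0)"
    and "span (e ` {..<n}) = span B"
    using gram_schmidt[OF assms(1,2)] by blast
  then have "orthonormal_frame g n e"
    using assms by (auto simp: orthonormal_frame_def orthonormal_basis_def)
  then show ?thesis by (rule that)
qed

text \<open>Gram-Schmidt only shows that the choice in \<open>induced_inner\<close> has a witness.
  The chosen function brings an orthonormal frame of its own, possibly a different one, and it is
  this frame that is returned.\<close>

lemma induced_inner_eq_frame_inner:
  fixes g :: "'a::real_vector \<Rightarrow> 'a \<Rightarrow> real" and B :: "'a set"
  assumes g: "inner_product_on UNIV g" and B: "finite B" "span B = UNIV"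
  obtains n e where "orthonormal_frame g n e"
    and "\<And>\<omega> \<eta>. \<lbrakk>\<omega> \<in> double_forms p q; \<eta> \<in> double_forms p q\<rbrakk>
      \<Longrightarrow> induced_inner g p q \<omega> \<eta> = orthonormal_frame.frame_inner n e p q \<omega> \<eta>"
proof -
  let ?P = "\<lambda>G. inner_product_on (double_forms p q) G \<and>
    (\<exists>n e. orthonormal_basis UNIV g {..<n} e \<and>
       orthonormal_basis (double_forms p q) G (increasing_indices n p \<times> increasing_indices n q)
         (\<lambda>(is, js). tensor (basis_form n e is) (basis_form n e js)))"
  obtain n e where f: "orthonormal_frame g n e" by (rule exists_orthonormal_frame[OF g B])
  have "?P (orthonormal_frame.frame_inner n e p q)"
    using orthonormal_frame.inner_product_frame_inner[OF f]
      orthonormal_frame.orthonormal_tensors[OF f] orthonormal_frame.basis[OF f] by blast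
  then have "?P (induced_inner g p q)"
    unfolding induced_inner_def by (rule someI[where P = ?P])
  then obtain m e' where ip: "inner_product_on (double_forms p q) (induced_inner g p q)"
    and b: "orthonormal_basis UNIV g {..<m} e'"
    and ON: "orthonormal_basis (double_forms p q) (induced_inner g p q)
      (increasing_indices m p \<times> increasing_indices m q)
      (\<lambda>(is, js). tensor (basis_form m e' is) (basis_form m e' js))"
    by blast
  have f': "orthonormal_frame g m e'" using g b by (rule orthonormal_frame.intro)
  show ?thesis
    by (rule that[OF f' orthonormal_frame.frame_inner_unique[OF f' ip ON]])
qed

section \<open>The composition product\<close>

lemma forms_sum:
  assumes "\<And>i. i \<in> A \<Longrightarrow> \<alpha> i \<in> forms p"
  shows "(\<lambda>xs. \<Sum>i\<in>A. c i * \<alpha> i xs) \<in> forms p"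
proof -
  have "(\<Sum>i\<in>A. c i *\<^sub>R \<alpha> i) \<in> forms p"
    by (intro subspace_sum[OF subspace_forms] subspace_scale[OF subspace_forms] assms)
  moreover have "(\<Sum>i\<in>A. c i *\<^sub>R \<alpha> i) = (\<lambda>xs. \<Sum>i\<in>A. c i * \<alpha> i xs)"
    by (rule ext) (simp add: sum_fun_apply)
  ultimately show ?thesis by simp
qed

text \<open>The generators are evaluations at a list, cut off to 0 outside \<open>forms p\<close>;
  so linearity is available on \<open>forms p\<close> only, and the summands have to lie
  there.\<close>

lemma multivector_sum:
  assumes \<xi>: "\<xi> \<in> multivectors p" and \<alpha>: "\<And>i. i \<in> A \<Longrightarrow> \<alpha> i \<in> forms p"
  shows "\<xi> (\<lambda>xs. \<Sum>i\<in>A. c i * \<alpha> i xs) = (\<Sum>i\<in>A. c i * \<xi> (\<alpha> i))"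
  using \<xi> unfolding multivectors_def
proof (induction rule: span_induct)
  case base
  show ?case
    by (auto simp: subspace_def sum.distrib distrib_left sum_distrib_left algebra_simps)
next
  case (step \<xi>)
  then obtain xs where "\<xi> = wedge_vectors xs" "length xs = p" by auto
  moreover have "(\<lambda>xs. \<Sum>i\<in>A. c i * \<alpha> i xs) \<in> forms p" by (rule forms_sum[OF \<alpha>])
  ultimately show ?case using \<alpha> by (simp add: wedge_vectors_def)
qed

text \<open>The cut-off passes to spans. It makes multivectors extensional, so that the description
  inside \<open>dform_to_endo\<close> can single out one function.\<close>

lemma multivector_outside_forms:
  assumes "\<xi> \<in> multivectors p" and "\<alpha> \<notin> forms p"
  shows "\<xi> \<alpha> = 0"
  using assms(1) unfolding multivectors_def
proof (induction rule: span_induct)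
  case base
  show ?case by (auto simp: subspace_def)
next
  case (step \<xi>)
  then show ?case using assms(2) by (auto simp: wedge_vectors_def)
qed

lemma wedge_vectors_in_multivectors: "length xs = p \<Longrightarrow> wedge_vectors xs \<in> multivectors p"
  unfolding multivectors_def by (rule span_base) simp

lemma sum_swap3:
  "(\<Sum>x\<in>A. \<Sum>y\<in>B. \<Sum>z\<in>C. f x y z) = (\<Sum>z\<in>C. \<Sum>x\<in>A. \<Sum>y\<in>B. f x y z)"
proof -
  have "(\<Sum>y\<in>B. \<Sum>z\<in>C. f x y z) = (\<Sum>z\<in>C. \<Sum>y\<in>B. f x y z)" for x by (rule sum.swap)
  then have "(\<Sum>x\<in>A. \<Sum>y\<in>B. \<Sum>z\<in>C. f x y z) = (\<Sum>x\<in>A. \<Sum>z\<in>C. \<Sum>y\<in>B. f x y z)"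
    by (rule sum.cong[OF refl])
  also have "\<dots> = (\<Sum>z\<in>C. \<Sum>x\<in>A. \<Sum>y\<in>B. f x y z)" by (rule sum.swap)
  finally show ?thesis .
qed

context orthonormal_frame
begin

lemma covector_det_gram_in_forms: "length ys = p \<Longrightarrow> covector_det (map g ys) \<in> forms p"
  using covector_det_in_forms[of "map g ys"] linear_g by auto

text \<open>The candidate raises the second argument of \<omega> by means of the frame. It has the
  required pairings because \<omega> expands in its second argument. It is the only one because the
  pairing with \<open>map e L\<close> reads off the value at \<open>eps L\<close>, and these forms
  span \<open>forms p\<close>.\<close>

lemma dform_to_endo:
  assumes \<omega>: "\<omega> \<in> double_forms p p" and \<xi>: "\<xi> \<in> multivectors p"
  shows "dform_to_endo g p \<omega> \<xi> =
      (\<Sum>L\<in>index_lists n p. (\<xi> (\<lambda>xs. \<omega> xs (map e L)) / fact p) *\<^sub>R wedge_vectors (map e L))"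
      (is "_ = ?\<eta>")
    and "dform_to_endo g p \<omega> \<xi> \<in> multivectors p"
    and "length ys = p \<Longrightarrow> inner_with_wedge g (dform_to_endo g p \<omega> \<xi>) ys = \<xi> (\<lambda>xs. \<omega> xs ys)"
proof -
  have mem: "?\<eta> \<in> multivectors p"
    unfolding multivectors_def
    by (intro span_sum span_scale span_base) (auto simp: index_lists_length)
  have val: "inner_with_wedge g ?\<eta> ys = \<xi> (\<lambda>xs. \<omega> xs ys)" if ys: "length ys = p" for ys
  proof -
    have "inner_with_wedge g ?\<eta> ys =
        (\<Sum>L\<in>index_lists n p. \<xi> (\<lambda>xs. \<omega> xs (map e L)) / fact p * eps L ys)"
      unfolding inner_with_wedge_def sum_fun_apply wedge_covectors_eq_det
    proof (rule sum.cong[OF refl])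
      fix L assume "L \<in> index_lists n p"
      then have "wedge_vectors (map e L) (covector_det (map g ys)) = covector_det (map g ys) (map e L)"
        using covector_det_gram_in_forms[OF ys] by (simp add: wedge_vectors_def index_lists_length)
      also have "\<dots> = eps L ys"
        using covector_det_gram_commute[of g ys "map e L", OF g_commute] by (simp add: o_def)
      finally show "((\<xi> (\<lambda>xs. \<omega> xs (map e L)) / fact p) *\<^sub>R wedge_vectors (map e L))
          (covector_det (map g ys)) = \<xi> (\<lambda>xs. \<omega> xs (map e L)) / fact p * eps L ys"
        by simp
    qed
    also have "\<dots> = (\<Sum>L\<in>index_lists n p. (eps L ys / fact p) * \<xi> (\<lambda>xs. \<omega> xs (map e L)))"
      by (simp add: mult.commute)
    also have "\<dots> = \<xi> (\<lambda>xs. \<Sum>L\<in>index_lists n p. (eps L ys / fact p) * \<omega> xs (map e L))"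
      by (rule multivector_sum[OF \<xi>, symmetric]) (rule double_formsD(1)[OF \<omega>])
    also have "(\<lambda>xs. \<Sum>L\<in>index_lists n p. (eps L ys / fact p) * \<omega> xs (map e L)) = (\<lambda>xs. \<omega> xs ys)"
    proof
      fix xs
      show "(\<Sum>L\<in>index_lists n p. (eps L ys / fact p) * \<omega> xs (map e L)) = \<omega> xs ys"
        by (subst (2) expansion[OF double_formsD(2)[OF \<omega>]])
          (simp add: sum_divide_distrib mult.commute)
    qed
    finally show ?thesis .
  qed
  show eq: "dform_to_endo g p \<omega> \<xi> = ?\<eta>"
    unfolding dform_to_endo_def
  proof (rule the_equality)
    fix \<eta>
    assume \<eta>: "\<eta> \<in> multivectors p \<and>
      (\<forall>ys. length ys = p \<longrightarrow> inner_with_wedge g \<eta> ys = \<xi> (\<lambda>xs. \<omega> xs ys))"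
    show "\<eta> = ?\<eta>"
    proof
      fix \<alpha>
      show "\<eta> \<alpha> = ?\<eta> \<alpha>"
      proof (cases "\<alpha> \<in> forms p")
        case True
        have \<alpha>: "\<alpha> = (\<lambda>xs. \<Sum>L\<in>index_lists n p. \<alpha> (map e L) / fact p * eps L xs)"
          by (rule ext, subst expansion[OF True]) (simp add: sum_divide_distrib)
        have basis: "\<eta> (eps L) = ?\<eta> (eps L)" if "L \<in> index_lists n p" for L
        proof -
          have "inner_with_wedge g \<eta> (map e L) = inner_with_wedge g ?\<eta> (map e L)"
            using \<eta> val[of "map e L"] index_lists_length[OF that] by simp
          then show ?thesis
            by (simp only: inner_with_wedge_def wedge_covectors_eq_det map_map o_def)
        qed
        have coeffs: "\<zeta> \<alpha> = (\<Sum>L\<in>index_lists n p. \<alpha> (map e L) / fact p * \<zeta> (eps L))"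
          if "\<zeta> \<in> multivectors p" for \<zeta>
        proof -
          have "\<zeta> \<alpha> = \<zeta> (\<lambda>xs. \<Sum>L\<in>index_lists n p. \<alpha> (map e L) / fact p * eps L xs)"
            by (rule arg_cong[OF \<alpha>])
          also have "\<dots> = (\<Sum>L\<in>index_lists n p. \<alpha> (map e L) / fact p * \<zeta> (eps L))"
            by (rule multivector_sum[OF that]) (rule eps_in_forms, rule index_lists_length)
          finally show ?thesis .
        qed
        have "\<eta> \<alpha> = (\<Sum>L\<in>index_lists n p. \<alpha> (map e L) / fact p * \<eta> (eps L))"
          using \<eta> by (intro coeffs) blast
        also have "\<dots> = (\<Sum>L\<in>index_lists n p. \<alpha> (map e L) / fact p * ?\<eta> (eps L))"
          by (rule sum.cong[OF refl]) (simp only: basis)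
        also have "\<dots> = ?\<eta> \<alpha>" by (rule coeffs[OF mem, symmetric])
        finally show ?thesis .
      next
        case False
        then show ?thesis
          using multivector_outside_forms[of \<eta> p \<alpha>] multivector_outside_forms[OF mem False] \<eta>
          by (simp only: simp_thms)
      qed
    qed
  qed (intro conjI allI impI mem val)
  show "dform_to_endo g p \<omega> \<xi> \<in> multivectors p" unfolding eq by (rule mem)
  show "length ys = p \<Longrightarrow> inner_with_wedge g (dform_to_endo g p \<omega> \<xi>) ys = \<xi> (\<lambda>xs. \<omega> xs ys)"
    unfolding eq by (rule val)
qed

text \<open>A matrix product: \<omega>2 acts first, so its second argument is contracted with the
  first argument of \<omega>1. The sum over all lists counts each index set \<open>p!\<close>
  times.\<close>

lemma dcomp_eq:
  assumes \<omega>1: "\<omega>1 \<in> double_forms p p" and \<omega>2: "\<omega>2 \<in> double_forms p p"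
  shows "dcomp g p \<omega>1 \<omega>2 xs ys =
    (\<Sum>L\<in>index_lists n p. \<omega>2 xs (map e L) * \<omega>1 (map e L) ys) / fact p"
proof (cases "length xs = p \<and> length ys = p")
  case True
  let ?\<xi> = "dform_to_endo g p \<omega>2 (wedge_vectors xs)"
  have xs: "wedge_vectors xs \<in> multivectors p" using True by (simp add: wedge_vectors_in_multivectors)
  have "dcomp g p \<omega>1 \<omega>2 xs ys = ?\<xi> (\<lambda>xs. \<omega>1 xs ys)"
    using True dform_to_endo(3)[OF \<omega>1 dform_to_endo(2)[OF \<omega>2 xs]]
    by (simp add: dcomp_def endo_to_dform_def)
  also have "\<dots> = (\<Sum>L\<in>index_lists n p. \<omega>2 xs (map e L) * \<omega>1 (map e L) ys / fact p)"
    unfolding dform_to_endo(1)[OF \<omega>2 xs] sum_fun_apply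
    by (rule sum.cong)
      (use True double_formsD(1)[OF \<omega>1] double_formsD(1)[OF \<omega>2] in
        \<open>auto simp: wedge_vectors_def index_lists_length\<close>)
  finally show ?thesis by (simp add: sum_divide_distrib)
next
  case False
  have "\<omega>2 xs (map e L) * \<omega>1 (map e L) ys = 0" for L
    using False formsD(1)[OF double_formsD(1)[OF \<omega>2]] formsD(1)[OF double_formsD(2)[OF \<omega>1]]
    by auto
  then have "(\<Sum>L\<in>index_lists n p. \<omega>2 xs (map e L) * \<omega>1 (map e L) ys) = 0"
    by (intro sum.neutral) blast
  then show ?thesis using False by (auto simp: dcomp_def endo_to_dform_def)
qed

lemma dcomp_in_double_forms:
  assumes \<omega>1: "\<omega>1 \<in> double_forms p p" and \<omega>2: "\<omega>2 \<in> double_forms p p"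
  shows "dcomp g p \<omega>1 \<omega>2 \<in> double_forms p p"
proof (rule double_formsI)
  fix ys
  have eq: "(\<lambda>xs. dcomp g p \<omega>1 \<omega>2 xs ys) =
      (\<lambda>xs. \<Sum>L\<in>index_lists n p. (\<omega>1 (map e L) ys / fact p) * \<omega>2 xs (map e L))"
    by (rule ext) (simp add: dcomp_eq[OF assms] sum_divide_distrib mult.commute)
  show "(\<lambda>xs. dcomp g p \<omega>1 \<omega>2 xs ys) \<in> forms p"
    unfolding eq by (rule forms_sum) (rule double_formsD(1)[OF \<omega>2])
next
  fix xs
  have eq: "dcomp g p \<omega>1 \<omega>2 xs =
      (\<lambda>ys. \<Sum>L\<in>index_lists n p. (\<omega>2 xs (map e L) / fact p) * \<omega>1 (map e L) ys)"
    by (rule ext) (simp add: dcomp_eq[OF assms] sum_divide_distrib)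
  show "dcomp g p \<omega>1 \<omega>2 xs \<in> forms p"
    unfolding eq by (rule forms_sum) (rule double_formsD(2)[OF \<omega>1])
qed

section \<open>Powers of the metric and the derivation attached to \<open>h\<close>\<close>

lemma bilinear_dform_expansion:
  assumes b1: "\<And>y. linear (\<lambda>x. b x y)" and b2: "\<And>x. linear (b x)"
  shows "bilinear_dform b = (\<Sum>a<n. \<Sum>c<n.
    b (e a) (e c) *\<^sub>R tensor (covector_form (g (e a))) (covector_form (g (e c))))"
proof (intro ext)
  fix xs ys
  have eq: "b x y = (\<Sum>a<n. \<Sum>c<n. b (e a) (e c) * (g (e a) x * g (e c) y))" for x y
  proof -
    have 2: "b v y = (\<Sum>c<n. g (e c) y * b v (e c))" for v
      using arg_cong[OF coordinates[of y], of "b v"]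
      by (simp only: linear_sum[OF b2] linear_scale[OF b2] real_scaleR_def)
    have "b x y = (\<Sum>a<n. g (e a) x * b (e a) y)"
      using arg_cong[OF coordinates[of x], of "\<lambda>x. b x y"]
      by (simp only: linear_sum[OF b1] linear_scale[OF b1] real_scaleR_def)
    also have "\<dots> = (\<Sum>a<n. \<Sum>c<n. b (e a) (e c) * (g (e a) x * g (e c) y))"
      by (subst 2) (simp add: sum_distrib_left algebra_simps)
    finally show ?thesis .
  qed
  show "bilinear_dform b xs ys = (\<Sum>a<n. \<Sum>c<n.
      b (e a) (e c) *\<^sub>R tensor (covector_form (g (e a))) (covector_form (g (e c)))) xs ys"
  proof (cases "length xs = 1 \<and> length ys = 1")
    case True
    then have "bilinear_dform b xs ys = b (hd xs) (hd ys)" by (simp add: bilinear_dform_def)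
    also note eq
    finally show ?thesis using True by (simp add: sum_fun_apply tensor_def covector_form_def)
  qed (auto simp: bilinear_dform_def sum_fun_apply tensor_def covector_form_def)
qed

lemma bilinear_dform_metric:
  "bilinear_dform g = (\<Sum>a<n. tensor (covector_form (g (e a))) (covector_form (g (e a))))"
proof -
  have "bilinear_dform g = (\<Sum>a<n. \<Sum>c<n.
      g (e a) (e c) *\<^sub>R tensor (covector_form (g (e a))) (covector_form (g (e c))))"
    using inner_product_onD(2,3)[OF inner] by (rule bilinear_dform_expansion[rotated])
  also have "\<dots> = (\<Sum>a<n. \<Sum>c<n. if c = a
      then tensor (covector_form (g (e a))) (covector_form (g (e c))) else 0)"
    by (intro sum.cong refl) (auto simp: g_basis)
  finally show ?thesis by simp
qed

lemma eps_Cons: "eps (a # L) = wedge (covector_form (g (e a))) (eps L)"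
  by (simp add: covector_form_eq_det wedge_covector_det)

lemma eps_snoc: "eps (L @ [a]) = wedge (eps L) (covector_form (g (e a)))"
  by (simp add: covector_form_eq_det wedge_covector_det)

lemma dmult_sum_left: "dmult (\<Sum>i\<in>A. f i) \<eta> = (\<Sum>i\<in>A. dmult (f i) \<eta>)"
  and dmult_sum_right: "dmult \<eta> (\<Sum>i\<in>A. f i) = (\<Sum>i\<in>A. dmult \<eta> (f i))"
  and dmult_scale_right: "dmult \<eta> (c *\<^sub>R \<omega>) = c *\<^sub>R dmult \<eta> \<omega>"
  using bilinear_dmult linear_sum[of "\<lambda>x. dmult x \<eta>" f A] linear_sum[of "dmult \<eta>" f A]
    linear_scale[of "dmult \<eta>" c \<omega>]
  by (auto simp: bilinear_def)

text \<open>Each further factor \<open>g\<close> puts one common index in front of both lists.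
  Unsorted lists absorb a factorial: collected by increasing lists, the right side is
  \<open>k!\<close> times the tensor of the identity.\<close>

lemma dpower_metric:
  "dpower (bilinear_dform g) k = (\<Sum>L\<in>index_lists n k. tensor (eps L) (eps L))"
proof (induction k)
  case 0
  then show ?case by (simp add: dpower_def unit_form_eq_det)
next
  case (Suc k)
  have "dpower (bilinear_dform g) (Suc k) = dmult (bilinear_dform g) (dpower (bilinear_dform g) k)"
    by (simp add: dpower_def)
  also have "\<dots> = (\<Sum>a<n. \<Sum>L\<in>index_lists n k. tensor (eps (a # L)) (eps (a # L)))"
    unfolding Suc
    unfolding bilinear_dform_metric dmult_sum_left
    unfolding dmult_sum_right dmult_tensor eps_Cons ..
  finally show ?case by (simp only: sum_index_lists_Cons)
qed

text \<open>For symmetric \<open>h\<close> the corresponding endomorphism is the extension, as a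
  derivation of the exterior algebra, of the \<open>g\<close>-self-adjoint map attached to
  \<open>h\<close>; for \<open>p = 1\<close> it is that map.\<close>

definition derivation_dform :: "('a \<Rightarrow> 'a \<Rightarrow> real) \<Rightarrow> nat \<Rightarrow> 'a dform"
  where "derivation_dform h p =
    (1 / fact (p - 1)) *\<^sub>R dmult (dpower (bilinear_dform g) (p - 1)) (bilinear_dform h)"

lemma F_op_eq:
  "F_op g h p \<omega> = dcomp g p (derivation_dform h p) \<omega> + dcomp g p \<omega> (derivation_dform h p)"
  by (simp add: F_op_def derivation_dform_def Let_def)

lemma derivation_dform_eq:
  assumes "\<And>y. linear (\<lambda>x. h x y)" and "\<And>x. linear (h x)"
  shows "derivation_dform h p = (1 / fact (p - 1)) *\<^sub>R
    (\<Sum>N\<in>index_lists n (p - 1). \<Sum>a<n. \<Sum>c<n. h (e a) (e c) *\<^sub>R tensor (eps (N @ [a])) (eps (N @ [c])))"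
  unfolding derivation_dform_def dpower_metric dmult_sum_left
  unfolding bilinear_dform_expansion[of h, OF assms] dmult_sum_right dmult_scale_right
    dmult_tensor eps_snoc ..

lemma derivation_dform_in_double_forms:
  assumes "\<And>y. linear (\<lambda>x. h x y)" and "\<And>x. linear (h x)" and "p \<ge> 1"
  shows "derivation_dform h p \<in> double_forms p p"
proof -
  have "tensor (eps (N @ [a])) (eps (N @ [c])) \<in> double_forms p p"
    if "N \<in> index_lists n (p - 1)" for N a c
    using that assms(3) by (intro tensor_in_double_forms eps_in_forms) (simp_all add: index_lists_length)
  moreover have "subspace (double_forms p p :: 'a dform set)"
    unfolding double_forms_def by (rule subspace_span)
  ultimately show ?thesis
    unfolding derivation_dform_eq[of h, OF assms(1,2)]
    by (intro subspace_scale subspace_sum) auto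
qed

text \<open>For \<open>p\<close>-forms this is \<open>p!\<close> times the inner product of \<beta>
  with the form obtained from \<alpha> by letting \<open>h\<close> act as a derivation. By
  alternation all slots give the same sum, so only the last one is written and it is counted
  \<open>p\<close> times.\<close>

definition contraction :: "('a \<Rightarrow> 'a \<Rightarrow> real) \<Rightarrow> nat \<Rightarrow> 'a form \<Rightarrow> 'a form \<Rightarrow> real"
  where "contraction h p \<alpha> \<beta> = real p * (\<Sum>N\<in>index_lists n (p - 1). \<Sum>a<n. \<Sum>c<n.
    h (e a) (e c) * (\<alpha> (map e (N @ [a])) * \<beta> (map e (N @ [c]))))"

lemma contraction_commute:
  assumes "\<And>x y. h x y = h y x"
  shows "contraction h p \<alpha> \<beta> = contraction h p \<beta> \<alpha>"
proof -
  have "(\<Sum>a<n. \<Sum>c<n. h (e a) (e c) * (\<alpha> (map e (N @ [a])) * \<beta> (map e (N @ [c])))) =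
      (\<Sum>a<n. \<Sum>c<n. h (e a) (e c) * (\<beta> (map e (N @ [a])) * \<alpha> (map e (N @ [c]))))" for N
    by (subst sum.swap) (simp add: assms[of "e _" "e _"] mult.commute)
  then show ?thesis by (simp add: contraction_def)
qed

text \<open>Once the derivation is expanded in the frame, the sums over \<open>L\<close> and
  \<open>M\<close> separate. \<open>sum_eps\<close> evaluates each of them and gives
  \<open>p!\<close> twice, and \<open>p! * p!/(p - 1)!\<close> is \<open>p! * p\<close>.\<close>

lemma derivation_pairing:
  assumes h: "\<And>y. linear (\<lambda>x. h x y)" "\<And>x. linear (h x)" and p: "p \<ge> 1"
    and \<alpha>: "\<alpha> \<in> forms p" and \<beta>: "\<beta> \<in> forms p"
  shows "(\<Sum>L\<in>index_lists n p. \<Sum>M\<in>index_lists n p.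
      derivation_dform h p (map e L) (map e M) * (\<alpha> (map e L) * \<beta> (map e M))) =
    fact p * contraction h p \<alpha> \<beta>"
proof -
  let ?T = "\<lambda>N a c L M. h (e a) (e c) * ((\<alpha> (map e L) * eps (N @ [a]) (map e L)) *
      (\<beta> (map e M) * eps (N @ [c]) (map e M)))"
  have "(\<Sum>L\<in>index_lists n p. \<Sum>M\<in>index_lists n p.
      derivation_dform h p (map e L) (map e M) * (\<alpha> (map e L) * \<beta> (map e M))) =
    (\<Sum>L\<in>index_lists n p. \<Sum>M\<in>index_lists n p. \<Sum>N\<in>index_lists n (p - 1). \<Sum>a<n. \<Sum>c<n.
      ?T N a c L M / fact (p - 1))"
    unfolding derivation_dform_eq[of h, OF h] scaleR_fun_apply sum_fun_apply tensor_def
      sum_distrib_left sum_distrib_right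
    by (intro sum.cong refl)
      (simp add: sum_distrib_left sum_distrib_right sum_divide_distrib algebra_simps)
  also have "\<dots> = (\<Sum>N\<in>index_lists n (p - 1). \<Sum>a<n. \<Sum>c<n.
      \<Sum>L\<in>index_lists n p. \<Sum>M\<in>index_lists n p. ?T N a c L M / fact (p - 1))"
    by (rule trans[OF sum_swap3 sum.cong[OF refl]], rule trans[OF sum_swap3 sum.cong[OF refl]],
        rule sum_swap3)
  also have "\<dots> = (\<Sum>N\<in>index_lists n (p - 1). \<Sum>a<n. \<Sum>c<n. h (e a) (e c) *
      ((\<Sum>L\<in>index_lists n p. \<alpha> (map e L) * eps (N @ [a]) (map e L)) *
       (\<Sum>M\<in>index_lists n p. \<beta> (map e M) * eps (N @ [c]) (map e M))) / fact (p - 1))"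
    unfolding sum_product
    unfolding sum_distrib_left sum_divide_distrib ..
  also have "\<dots> = (\<Sum>N\<in>index_lists n (p - 1). \<Sum>a<n. \<Sum>c<n.
      fact p * (real p * (h (e a) (e c) * (\<alpha> (map e (N @ [a])) * \<beta> (map e (N @ [c]))))))"
  proof -
    \<comment> \<open>Subtraction in \<open>p - 1\<close> is truncated, so p \<ge> 1 enters
      here.\<close>
    have "(fact p :: real) = real p * fact (p - 1)" using p by (simp add: fact_reduce)
    then show ?thesis
      unfolding sum_eps[OF \<alpha>] sum_eps[OF \<beta>]
      by (intro sum.cong refl) (simp add: field_simps del: map_append)
  qed
  also have "\<dots> = fact p * contraction h p \<alpha> \<beta>"
    unfolding contraction_def sum_distrib_left ..
  finally show ?thesis .
qed

text \<open>Composing with the derivation on the left contracts the second argument of \<omega>, on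
  the right the first. The \<open>1/p!\<close> of \<open>dcomp\<close> cancels the \<open>p!\<close>
  of \<open>derivation_pairing\<close>.\<close>

lemma frame_inner_F_op:
  assumes h: "\<And>y. linear (\<lambda>x. h x y)" "\<And>x. linear (h x)" "\<And>x y. h x y = h y x"
    and p: "p \<ge> 1" and \<omega>: "\<omega> \<in> double_forms p p" and \<eta>: "\<eta> \<in> double_forms p p"
  shows "frame_inner p p (F_op g h p \<omega>) \<eta> =
    ((\<Sum>L\<in>index_lists n p. contraction h p (\<omega> (map e L)) (\<eta> (map e L))) +
     (\<Sum>M\<in>index_lists n p. contraction h p (\<lambda>xs. \<omega> xs (map e M)) (\<lambda>xs. \<eta> xs (map e M))))
    / (fact p * fact p)"
proof -
  let ?I = "index_lists n p" and ?K = "derivation_dform h p"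
  have K: "?K \<in> double_forms p p" by (rule derivation_dform_in_double_forms[OF h(1,2) p])
  have 1: "(\<Sum>L\<in>?I. \<Sum>M\<in>?I. dcomp g p ?K \<omega> (map e L) (map e M) * \<eta> (map e L) (map e M)) =
      (\<Sum>L\<in>?I. contraction h p (\<omega> (map e L)) (\<eta> (map e L)))"
  proof (rule sum.cong[OF refl])
    fix L
    have "(\<Sum>M\<in>?I. dcomp g p ?K \<omega> (map e L) (map e M) * \<eta> (map e L) (map e M)) =
        (\<Sum>M\<in>?I. \<Sum>N\<in>?I. ?K (map e N) (map e M) * (\<omega> (map e L) (map e N) * \<eta> (map e L) (map e M))) / fact p"
      unfolding dcomp_eq[OF K \<omega>] sum_divide_distrib sum_distrib_right
      by (intro sum.cong refl) (simp add: algebra_simps)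
    also have "\<dots> = contraction h p (\<omega> (map e L)) (\<eta> (map e L))"
      by (subst sum.swap, subst derivation_pairing[OF h(1,2) p double_formsD(2)[OF \<omega>] double_formsD(2)[OF \<eta>]])
        simp
    finally show "(\<Sum>M\<in>?I. dcomp g p ?K \<omega> (map e L) (map e M) * \<eta> (map e L) (map e M)) =
        contraction h p (\<omega> (map e L)) (\<eta> (map e L))" .
  qed
  have 2: "(\<Sum>M\<in>?I. \<Sum>L\<in>?I. dcomp g p \<omega> ?K (map e L) (map e M) * \<eta> (map e L) (map e M)) =
      (\<Sum>M\<in>?I. contraction h p (\<lambda>xs. \<omega> xs (map e M)) (\<lambda>xs. \<eta> xs (map e M)))"
  proof (rule sum.cong[OF refl])
    fix M
    have "(\<Sum>L\<in>?I. dcomp g p \<omega> ?K (map e L) (map e M) * \<eta> (map e L) (map e M)) =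
        (\<Sum>L\<in>?I. \<Sum>N\<in>?I. ?K (map e L) (map e N) * (\<eta> (map e L) (map e M) * \<omega> (map e N) (map e M))) / fact p"
      unfolding dcomp_eq[OF \<omega> K] sum_divide_distrib sum_distrib_right
      by (intro sum.cong refl) (simp add: algebra_simps)
    also have "\<dots> = contraction h p (\<lambda>xs. \<eta> xs (map e M)) (\<lambda>xs. \<omega> xs (map e M))"
      by (subst derivation_pairing[OF h(1,2) p double_formsD(1)[OF \<eta>] double_formsD(1)[OF \<omega>]]) simp
    \<comment> \<open>Here \<eta> meets the first argument of the derivation, so the two forms come
      out in reverse order; symmetry of \<open>h\<close> restores it.\<close>
    also have "\<dots> = contraction h p (\<lambda>xs. \<omega> xs (map e M)) (\<lambda>xs. \<eta> xs (map e M))"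
      by (rule contraction_commute[OF h(3)])
    finally show "(\<Sum>L\<in>?I. dcomp g p \<omega> ?K (map e L) (map e M) * \<eta> (map e L) (map e M)) =
        contraction h p (\<lambda>xs. \<omega> xs (map e M)) (\<lambda>xs. \<eta> xs (map e M))" .
  qed
  show ?thesis
    unfolding 1[symmetric] 2[symmetric] frame_inner_def F_op_eq
    by (subst (3) sum.swap) (simp add: sum.distrib distrib_right)
qed

lemma F_op_in_double_forms:
  assumes "\<And>y. linear (\<lambda>x. h x y)" "\<And>x. linear (h x)" "p \<ge> 1" "\<omega> \<in> double_forms p p"
  shows "F_op g h p \<omega> \<in> double_forms p p"
  using dcomp_in_double_forms[OF derivation_dform_in_double_forms[OF assms(1-3)] assms(4)]
    dcomp_in_double_forms[OF assms(4) derivation_dform_in_double_forms[OF assms(1-3)]]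
  unfolding F_op_eq double_forms_def by (rule span_add)

end

section \<open>Variation of the metric\<close>

text \<open>The identity \<open>A = 1 - A (M - 1)\<close> first bounds \<open>A\<close> near \<open>0\<close>, then gives its continuity at \<open>0\<close>,
  and finally, divided by \<open>t\<close>, its derivative.\<close>

lemma has_derivative_left_inverse:
  fixes A M :: "real \<Rightarrow> nat \<Rightarrow> nat \<Rightarrow> real"
  assumes M0: "\<And>a b. \<lbrakk>a < n; b < n\<rbrakk> \<Longrightarrow> M 0 a b = of_bool (a = b)"
    and DM: "\<And>a b. \<lbrakk>a < n; b < n\<rbrakk> \<Longrightarrow> ((\<lambda>t. M t a b) has_real_derivative H a b) (at 0)"
    and inv: "eventually (\<lambda>t. \<forall>a<n. \<forall>c<n. (\<Sum>b<n. A t a b * M t b c) = of_bool (a = c)) (nhds 0)"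
    and ac: "a < n" "c < n"
  shows "A 0 a c = of_bool (a = c)" and "((\<lambda>t. A t a c) has_real_derivative - H a c) (at 0)"
proof -
  \<comment> \<open>The deviation of \<open>M\<close> from the identity: it tends to 0, and divided
    by \<open>t\<close> it is the difference quotient of \<open>M\<close>, which tends to
    \<open>H\<close>.\<close>
  define E where "E t b c = M t b c - of_bool (b = c)" for t b c
  have E0: "((\<lambda>t. E t b c) \<longlongrightarrow> 0) (at 0)" if "b < n" "c < n" for b c
  proof -
    have "((\<lambda>t. M t b c) \<longlongrightarrow> M 0 b c) (at 0)"
      using DERIV_isCont[OF DM[OF that]] by (simp add: isCont_def)
    then show ?thesis using LIM_zero[of "\<lambda>t. M t b c" "M 0 b c" "at 0"] by (simp add: E_def M0 that)
  qed
  have expand: "A t a c = of_bool (a = c) - (\<Sum>b<n. A t a b * E t b c)"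
    if "\<forall>a<n. \<forall>c<n. (\<Sum>b<n. A t a b * M t b c) = of_bool (a = c)" "a < n" "c < n" for t a c
  proof -
    have "(\<Sum>b<n. A t a b * E t b c) = (\<Sum>b<n. A t a b * M t b c) - (\<Sum>b<n. A t a b * of_bool (b = c))"
      by (simp add: E_def right_diff_distrib sum_subtractf)
    also have "(\<Sum>b<n. A t a b * of_bool (b = c)) = A t a c"
      using that(3) by (simp add: of_bool_def if_distrib cong: if_cong)
    finally show ?thesis using that by simp
  qed
  \<comment> \<open>A neighbourhood of 0 contains 0, so the equation also holds there and fixes
    \<open>A 0\<close>; the limits below only need it off 0.\<close>
  have inv0: "\<forall>a<n. \<forall>c<n. (\<Sum>b<n. A 0 a b * M 0 b c) = of_bool (a = c)"
    by (rule eventually_nhds_x_imp_x[OF inv])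
  have A0: "A 0 a c = of_bool (a = c)" if "a < n" "c < n" for a c
    using expand[OF inv0 that] that by (simp add: E_def M0)
  have ev: "eventually (\<lambda>t. \<forall>a<n. \<forall>c<n. A t a c = of_bool (a = c) - (\<Sum>b<n. A t a b * E t b c)) (at 0)"
    unfolding eventually_at_filter
    by (rule eventually_mono[OF inv]) (intro impI allI, rule expand, assumption+)
  \<comment> \<open>Summing the entrywise estimate gives
    \<open>S t \<le> n\<^sup>2 + S t * \<epsilon> t\<close>. Once \<epsilon> is below 1/2 the last
    term is absorbed on the left, which is where the bound \<open>2 * (real n * real n)\<close>
    comes from.\<close>
  define S where "S t = (\<Sum>a<n. \<Sum>c<n. \<bar>A t a c\<bar>)" for t
  define \<epsilon> where "\<epsilon> t = (\<Sum>b<n. \<Sum>c<n. \<bar>E t b c\<bar>)" for t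
  have "((\<lambda>t. \<Sum>b<n. \<Sum>c<n. \<bar>E t b c\<bar>) \<longlongrightarrow> (\<Sum>b<n. \<Sum>c<n. \<bar>0\<bar>)) (at 0)"
    by (intro tendsto_sum tendsto_rabs E0) auto
  then have "(\<epsilon> \<longlongrightarrow> 0) (at 0)" by (simp add: \<epsilon>_def[abs_def])
  then have "eventually (\<lambda>t. \<epsilon> t < 1/2) (at 0)" by (rule order_tendstoD(2)) simp
  with ev have S_bound: "eventually (\<lambda>t. S t \<le> 2 * (real n * real n)) (at 0)"
  proof eventually_elim
    case (elim t)
    have pt: "\<bar>A t a c\<bar> \<le> 1 + (\<Sum>b<n. \<bar>A t a b\<bar> * \<bar>E t b c\<bar>)" if "a < n" "c < n" for a c
    proof -
      have "A t a c = of_bool (a = c) - (\<Sum>b<n. A t a b * E t b c)" using elim(1) that by blast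
      then have "\<bar>A t a c\<bar> \<le> \<bar>of_bool (a = c)\<bar> + \<bar>\<Sum>b<n. A t a b * E t b c\<bar>"
        by (rule ord_eq_le_trans[OF arg_cong[where f = abs] abs_triangle_ineq4])
      also have "\<dots> \<le> 1 + (\<Sum>b<n. \<bar>A t a b\<bar> * \<bar>E t b c\<bar>)"
        using sum_abs[of "\<lambda>b. A t a b * E t b c" "{..<n}"]
        by (intro add_mono) (simp, simp only: abs_mult)
      finally show ?thesis .
    qed
    have "S t \<le> (\<Sum>a<n. \<Sum>c<n. 1 + (\<Sum>b<n. \<bar>A t a b\<bar> * \<bar>E t b c\<bar>))"
      unfolding S_def by (intro sum_mono pt) auto
    also have "\<dots> = real n * real n + (\<Sum>a<n. \<Sum>c<n. \<Sum>b<n. \<bar>A t a b\<bar> * \<bar>E t b c\<bar>)"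
      by (simp add: sum.distrib)
    also have "(\<Sum>a<n. \<Sum>c<n. \<Sum>b<n. \<bar>A t a b\<bar> * \<bar>E t b c\<bar>) =
        (\<Sum>a<n. \<Sum>b<n. \<bar>A t a b\<bar> * (\<Sum>c<n. \<bar>E t b c\<bar>))"
      unfolding sum_distrib_left by (rule sum.cong[OF refl], rule sum.swap)
    also have "\<dots> \<le> (\<Sum>a<n. \<Sum>b<n. \<bar>A t a b\<bar> * \<epsilon> t)"
    proof (intro sum_mono mult_left_mono)
      fix b assume "b \<in> {..<n}"
      then show "(\<Sum>c<n. \<bar>E t b c\<bar>) \<le> \<epsilon> t"
        unfolding \<epsilon>_def by (intro member_le_sum[where f = "\<lambda>b. \<Sum>c<n. \<bar>E t b c\<bar>"] sum_nonneg) auto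
    qed simp
    also have "\<dots> = S t * \<epsilon> t" by (simp add: S_def sum_distrib_right)
    also have "\<dots> \<le> S t * (1/2)"
      using elim(2) by (intro mult_left_mono) (auto simp: S_def intro!: sum_nonneg)
    finally show ?case by simp
  qed
  have A_bound: "eventually (\<lambda>t. norm (A t a b) \<le> 2 * (real n * real n)) (at 0)" if "a < n" "b < n" for a b
    using S_bound
  proof eventually_elim
    case (elim t)
    have "\<bar>A t a b\<bar> \<le> (\<Sum>b<n. \<bar>A t a b\<bar>)"
      using that by (intro member_le_sum[where f = "\<lambda>b. \<bar>A t a b\<bar>"]) auto
    also have "\<dots> \<le> S t"
      unfolding S_def using that
      by (intro member_le_sum[where f = "\<lambda>a. \<Sum>b<n. \<bar>A t a b\<bar>"] sum_nonneg) auto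
    finally show ?case using elim by simp
  qed
  have A_lim: "((\<lambda>t. A t a b) \<longlongrightarrow> of_bool (a = b)) (at 0)" if "a < n" "b < n" for a b
  proof -
    have "((\<lambda>t. of_bool (a = b) - (\<Sum>k<n. A t a k * E t k b)) \<longlongrightarrow>
        of_bool (a = b) - (\<Sum>k<n. 0)) (at 0)"
      by (intro tendsto_diff tendsto_const tendsto_sum lim_null_mult_left_bounded[OF A_bound E0])
        (use that in auto)
    moreover have "eventually (\<lambda>t. of_bool (a = b) - (\<Sum>k<n. A t a k * E t k b) = A t a b) (at 0)"
      using ev
    proof eventually_elim
      case (elim t)
      then have "A t a b = of_bool (a = b) - (\<Sum>k<n. A t a k * E t k b)" using that by blast
      then show ?case by (rule sym)
    qed
    ultimately show ?thesis using Lim_transform_eventually by fastforce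
  qed
  have E_quot: "((\<lambda>t. E t b c / t) \<longlongrightarrow> H b c) (at 0)" if "b < n" "c < n" for b c
    using DM[OF that] by (simp add: has_field_derivative_iff E_def M0 that)
  have "((\<lambda>t. - (\<Sum>b<n. A t a b * (E t b c / t))) \<longlongrightarrow> - (\<Sum>b<n. of_bool (a = b) * H b c)) (at 0)"
    by (intro tendsto_minus tendsto_sum tendsto_mult A_lim E_quot) (use ac in auto)
  moreover have "(\<Sum>b<n. of_bool (a = b) * H b c) = H a c"
    using ac by (simp add: of_bool_def if_distrib[of "\<lambda>x. x * _"] cong: if_cong)
  moreover have "eventually (\<lambda>t. - (\<Sum>b<n. A t a b * (E t b c / t)) = (A t a c - A 0 a c) / (t - 0)) (at 0)"
    using ev
  proof eventually_elim
    case (elim t)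
    then have "A t a c = of_bool (a = c) - (\<Sum>b<n. A t a b * E t b c)" using ac by blast
    then have "A t a c - A 0 a c = - (\<Sum>b<n. A t a b * E t b c)" using A0[OF ac] by linarith
    then show ?case by (simp add: sum_divide_distrib)
  qed
  ultimately show "((\<lambda>t. A t a c) has_real_derivative - H a c) (at 0)"
    unfolding has_field_derivative_iff using Lim_transform_eventually by fastforce
  show "A 0 a c = of_bool (a = c)" by (rule A0[OF ac])
qed

lemma prod_of_bool_lists:
  assumes "length K = p" "length N = p"
  shows "(\<Prod>k<p. of_bool (K ! k = N ! k)) = (of_bool (K = N) :: real)"
proof -
  have "(\<Prod>k<p. of_bool (K ! k = N ! k)) = (of_bool (\<forall>k<p. K ! k = N ! k) :: real)"
    by (induction p) (auto simp: less_Suc_eq)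
  then show ?thesis using assms by (simp add: list_eq_iff_nth_eq)
qed

section \<open>Change of frame, and the derivative of the inverse Gram matrix\<close>

context orthonormal_frame
begin

text \<open>If \<open>e'\<close> is orthonormal for a metric, this is the inner product induced by
  that metric on the covectors dual to \<open>e a\<close> and \<open>e b\<close>; it depends on the
  metric only, not on the choice of \<open>e'\<close>.\<close>

definition dual_gram :: "nat \<Rightarrow> (nat \<Rightarrow> 'a) \<Rightarrow> nat \<Rightarrow> nat \<Rightarrow> real"
  where "dual_gram m e' a b = (\<Sum>i<m. g (e a) (e' i) * g (e b) (e' i))"

text \<open>A product over slots and not a determinant: antisymmetry is left to the forms with which
  it is paired.\<close>

definition dual_gram_lists :: "nat \<Rightarrow> (nat \<Rightarrow> 'a) \<Rightarrow> nat list \<Rightarrow> nat list \<Rightarrow> real"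
  where "dual_gram_lists m e' K N = (\<Prod>k<length K. dual_gram m e' (K ! k) (N ! k))"

text \<open>Two frame expansions: \<open>e' i\<close> in the frame \<open>e\<close> turns the sum
  over \<open>b\<close> into \<open>g' (e' i) (e c)\<close>, and then \<open>e c\<close> is expanded
  in the frame \<open>e'\<close>.\<close>

lemma dual_gram_left_inverse:
  assumes f': "orthonormal_frame g' m e'" and ac: "a < n" "c < n"
  shows "(\<Sum>b<n. dual_gram m e' a b * g' (e b) (e c)) = of_bool (a = c)"
proof -
  note lin' = inner_product_onD(3)[OF orthonormal_frame.inner[OF f']]
  have row: "(\<Sum>b<n. g (e b) v * g' (e b) (e c)) = g' v (e c)" for v
    using arg_cong[OF coordinates[of v], of "\<lambda>v. g' v (e c)"]
    by (simp only: linear_sum[OF lin'] linear_scale[OF lin'] real_scaleR_def)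
  have "(\<Sum>b<n. dual_gram m e' a b * g' (e b) (e c)) =
      (\<Sum>i<m. g (e a) (e' i) * (\<Sum>b<n. g (e b) (e' i) * g' (e b) (e c)))"
    unfolding dual_gram_def sum_distrib_left sum_distrib_right
    by (subst sum.swap) (simp add: mult.assoc)
  also have "\<dots> = (\<Sum>i<m. g (e a) (e' i) * g' (e' i) (e c))" by (simp only: row)
  also have "\<dots> = g (e a) (e c)"
    using arg_cong[OF orthonormal_frame.coordinates[OF f', of "e c"], of "g (e a)"]
    by (simp add: linear_sum[OF linear_g] linear_scale[OF linear_g] mult.commute)
  finally show ?thesis using ac by (simp add: g_basis)
qed

text \<open>Both values are expanded multilinearly in the fixed frame. After exchanging the sums
  only coordinates depend on \<open>L\<close>, and \<open>prod_sum_index_lists\<close> makes their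
  sum a product over slots.\<close>

lemma sum_change_frame:
  assumes \<alpha>: "\<alpha> \<in> forms p" and \<beta>: "\<beta> \<in> forms p"
  shows "(\<Sum>L\<in>index_lists m p. \<alpha> (map e' L) * \<beta> (map e' L)) =
    (\<Sum>K\<in>index_lists n p. \<Sum>N\<in>index_lists n p.
      dual_gram_lists m e' K N * (\<alpha> (map e K) * \<beta> (map e N)))"
proof -
  let ?c = "\<lambda>K L. \<Prod>k<p. g (e (K ! k)) (e' (L ! k))"
  have exp: "\<gamma> (map e' L) = (\<Sum>K\<in>index_lists n p. ?c K L * \<gamma> (map e K))"
    if "\<gamma> \<in> forms p" "L \<in> index_lists m p" for \<gamma> L
  proof -
    have "\<gamma> (map e' L) = (\<Sum>K\<in>index_lists n p.
        tensor_eval (map (\<lambda>a. g (e a)) K) (map e' L) * \<gamma> (map e K))"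
      using that by (intro forms_multilinear_expansion coordinates) (auto simp: index_lists_length)
    then show ?thesis
      using that(2) by (auto simp: tensor_eval_def index_lists_length intro!: sum.cong prod.cong)
  qed
  have "(\<Sum>L\<in>index_lists m p. \<alpha> (map e' L) * \<beta> (map e' L)) =
      (\<Sum>L\<in>index_lists m p. \<Sum>K\<in>index_lists n p. \<Sum>N\<in>index_lists n p.
        (?c K L * \<alpha> (map e K)) * (?c N L * \<beta> (map e N)))"
    by (rule sum.cong[OF refl]) (simp only: exp[OF \<alpha>] exp[OF \<beta>] sum_product)
  also have "\<dots> = (\<Sum>K\<in>index_lists n p. \<Sum>N\<in>index_lists n p. \<Sum>L\<in>index_lists m p.
        (?c K L * \<alpha> (map e K)) * (?c N L * \<beta> (map e N)))"
    by (rule sum_swap3[symmetric])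
  also have "\<dots> = (\<Sum>K\<in>index_lists n p. \<Sum>N\<in>index_lists n p.
      dual_gram_lists m e' K N * (\<alpha> (map e K) * \<beta> (map e N)))"
  proof (intro sum.cong refl)
    fix K N assume "K \<in> index_lists n p" "N \<in> index_lists n p"
    then have "dual_gram_lists m e' K N = (\<Sum>L\<in>index_lists m p. ?c K L * ?c N L)"
      by (simp add: dual_gram_lists_def dual_gram_def index_lists_length prod_sum_index_lists
          prod.distrib)
    then show "(\<Sum>L\<in>index_lists m p. (?c K L * \<alpha> (map e K)) * (?c N L * \<beta> (map e N))) =
        dual_gram_lists m e' K N * (\<alpha> (map e K) * \<beta> (map e N))"
      by (simp add: sum_distrib_left sum_distrib_right algebra_simps)
  qed
  finally show ?thesis .
qed

text \<open>The second arguments are converted first, with indices \<open>P\<close> and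
  \<open>Q\<close>, then the first ones, with \<open>K\<close> and \<open>N\<close>. The new frame
  survives only in the two weights.\<close>

lemma frame_inner_change:
  assumes f': "orthonormal_frame g' m e'"
    and \<omega>: "\<omega> \<in> double_forms p p" and \<eta>: "\<eta> \<in> double_forms p p"
  shows "orthonormal_frame.frame_inner m e' p p \<omega> \<eta> =
    (\<Sum>P\<in>index_lists n p. \<Sum>Q\<in>index_lists n p. \<Sum>K\<in>index_lists n p. \<Sum>N\<in>index_lists n p.
      dual_gram_lists m e' P Q * dual_gram_lists m e' K N *
      (\<omega> (map e K) (map e P) * \<eta> (map e N) (map e Q))) / (fact p * fact p)"
proof -
  let ?I = "index_lists n p" and ?J = "index_lists m p" and ?W = "dual_gram_lists m e'"
  have "(\<Sum>L\<in>?J. \<Sum>M\<in>?J. \<omega> (map e' L) (map e' M) * \<eta> (map e' L) (map e' M)) =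
      (\<Sum>L\<in>?J. \<Sum>P\<in>?I. \<Sum>Q\<in>?I. ?W P Q * (\<omega> (map e' L) (map e P) * \<eta> (map e' L) (map e Q)))"
    by (simp only: sum_change_frame[OF double_formsD(2)[OF \<omega>] double_formsD(2)[OF \<eta>]])
  also have "\<dots> = (\<Sum>P\<in>?I. \<Sum>Q\<in>?I. ?W P Q *
      (\<Sum>L\<in>?J. \<omega> (map e' L) (map e P) * \<eta> (map e' L) (map e Q)))"
    unfolding sum_distrib_left by (rule sum_swap3[symmetric])
  also have "\<dots> = (\<Sum>P\<in>?I. \<Sum>Q\<in>?I. \<Sum>K\<in>?I. \<Sum>N\<in>?I. ?W P Q * ?W K N *
      (\<omega> (map e K) (map e P) * \<eta> (map e N) (map e Q)))"
    by (simp only: sum_change_frame[OF double_formsD(1)[OF \<omega>] double_formsD(1)[OF \<eta>]]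
        sum_distrib_left mult.assoc)
  finally show ?thesis by (simp add: orthonormal_frame.frame_inner_def[OF f'])
qed

text \<open>Minus the derivative of \<open>dual_gram_lists\<close> at 0 by the product rule: one
  slot carries \<open>h\<close>, the others are Kronecker symbols.\<close>

definition variation :: "('a \<Rightarrow> 'a \<Rightarrow> real) \<Rightarrow> nat list \<Rightarrow> nat list \<Rightarrow> real"
  where "variation h K N = (\<Sum>k<length K. h (e (K ! k)) (e (N ! k)) *
    (\<Prod>j\<in>{..<length K} - {k}. of_bool (K ! j = N ! j)))"

text \<open>A transposition applied to both lists moves the slot carrying \<open>h\<close> to the
  last place; \<alpha> and \<beta> pick up the same sign, so all \<open>p\<close> slots agree. With
  the last slot distinguished, the Kronecker symbols identify the remaining indices.\<close>

lemma sum_variation: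
  assumes \<alpha>: "\<alpha> \<in> forms p" and \<beta>: "\<beta> \<in> forms p" and p: "p \<ge> 1"
  shows "(\<Sum>K\<in>index_lists n p. \<Sum>N\<in>index_lists n p. variation h K N * (\<alpha> (map e K) * \<beta> (map e N))) =
    contraction h p \<alpha> \<beta>"
proof -
  obtain q where q: "p = Suc q" using p by (cases p) auto
  let ?I = "index_lists n p"
  define D where "D k K N = h (e (K ! k)) (e (N ! k)) * (\<Prod>j\<in>{..<p} - {k}. of_bool (K ! j = N ! j))"
    for k and K N :: "nat list"
  let ?F = "\<lambda>k K N. D k K N * (\<alpha> (map e K) * \<beta> (map e N))"
  have last: "(\<Sum>K\<in>?I. \<Sum>N\<in>?I. ?F k K N) = (\<Sum>K\<in>?I. \<Sum>N\<in>?I. ?F q K N)" if k: "k < p" for k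
  proof -
    let ?\<sigma> = "Transposition.transpose k q"
    have \<sigma>: "?\<sigma> permutes {..<p}" using k q by (simp add: permutes_swap_id)
    have "(\<Sum>K\<in>?I. \<Sum>N\<in>?I. ?F q K N) =
        (\<Sum>K\<in>?I. \<Sum>N\<in>?I. ?F q (permute_list ?\<sigma> K) N)"
      by (rule sum_index_lists_permute[OF \<sigma>, of "\<lambda>K. \<Sum>N\<in>?I. ?F q K N", symmetric])
    also have "\<dots> = (\<Sum>K\<in>?I. \<Sum>N\<in>?I. ?F q (permute_list ?\<sigma> K) (permute_list ?\<sigma> N))"
      by (rule sum.cong[OF refl], rule sum_index_lists_permute[OF \<sigma>, symmetric])
    also have "\<dots> = (\<Sum>K\<in>?I. \<Sum>N\<in>?I. ?F k K N)"
    proof (intro sum.cong refl)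
      fix K N assume K: "K \<in> ?I" and N: "N \<in> ?I"
      note len = index_lists_length[OF K] index_lists_length[OF N]
      have "D q (permute_list ?\<sigma> K) (permute_list ?\<sigma> N) = h (e (K ! k)) (e (N ! k)) *
          (\<Prod>j\<in>{..<p} - {q}. of_bool (K ! ?\<sigma> j = N ! ?\<sigma> j))"
        unfolding D_def using \<sigma> len q
        by (intro arg_cong2[of _ _ _ _ "(*)"] prod.cong) (auto simp: permute_list_nth)
      also have "(\<Prod>j\<in>{..<p} - {q}. of_bool (K ! ?\<sigma> j = N ! ?\<sigma> j)) =
          (\<Prod>j\<in>{..<p} - {k}. (of_bool (K ! j = N ! j) :: real))"
        by (rule prod.reindex_bij_witness[of _ ?\<sigma> ?\<sigma>])
          (use k q in \<open>auto simp: Transposition.transpose_def split: if_splits\<close>)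
      finally have "D q (permute_list ?\<sigma> K) (permute_list ?\<sigma> N) = D k K N" by (simp add: D_def)
      moreover have "\<alpha> (map e (permute_list ?\<sigma> K)) * \<beta> (map e (permute_list ?\<sigma> N)) =
          \<alpha> (map e K) * \<beta> (map e N)"
        using forms_permute[OF \<alpha>, of "map e K", OF _ \<sigma>] forms_permute[OF \<beta>, of "map e N", OF _ \<sigma>]
          \<sigma> len by (simp add: permute_list_map sign_swap_id)
      ultimately show "?F q (permute_list ?\<sigma> K) (permute_list ?\<sigma> N) = ?F k K N" by (simp only:)
    qed
    finally show ?thesis by simp
  qed
  have "(\<Sum>K\<in>?I. \<Sum>N\<in>?I. variation h K N * (\<alpha> (map e K) * \<beta> (map e N))) =
      (\<Sum>K\<in>?I. \<Sum>N\<in>?I. \<Sum>k<p. ?F k K N)"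
    by (intro sum.cong refl) (simp add: variation_def D_def index_lists_length sum_distrib_right)
  also have "\<dots> = (\<Sum>k<p. \<Sum>K\<in>?I. \<Sum>N\<in>?I. ?F k K N)" by (rule sum_swap3)
  also have "\<dots> = real p * (\<Sum>K\<in>?I. \<Sum>N\<in>?I. ?F q K N)"
  proof -
    have "(\<Sum>k<p. \<Sum>K\<in>?I. \<Sum>N\<in>?I. ?F k K N) = (\<Sum>k<p. \<Sum>K\<in>?I. \<Sum>N\<in>?I. ?F q K N)"
      by (rule sum.cong[OF refl], rule last) simp
    then show ?thesis by simp
  qed
  also have "(\<Sum>K\<in>?I. \<Sum>N\<in>?I. ?F q K N) = (\<Sum>K\<in>index_lists n q. \<Sum>a<n. \<Sum>N\<in>index_lists n q. \<Sum>c<n.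
      of_bool (K = N) * (h (e a) (e c) * (\<alpha> (map e (K @ [a])) * \<beta> (map e (N @ [c])))))"
    unfolding q sum_index_lists_snoc
  proof (intro sum.cong refl)
    fix K N a c assume KN: "K \<in> index_lists n q" "N \<in> index_lists n q"
    note len = index_lists_length[OF KN(1)] index_lists_length[OF KN(2)]
    have "{..<p} - {q} = {..<q}" using q by auto
    then have "(\<Prod>j\<in>{..<p} - {q}. of_bool ((K @ [a]) ! j = (N @ [c]) ! j)) = (of_bool (K = N) :: real)"
      using prod_of_bool_lists[OF len] len by (simp add: nth_append)
    then have "D q (K @ [a]) (N @ [c]) = h (e a) (e c) * of_bool (K = N)"
      using len by (simp add: D_def nth_append)
    then show "D q (K @ [a]) (N @ [c]) * (\<alpha> (map e (K @ [a])) * \<beta> (map e (N @ [c]))) =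
        of_bool (K = N) * (h (e a) (e c) * (\<alpha> (map e (K @ [a])) * \<beta> (map e (N @ [c]))))"
      by simp
  qed
  also have "\<dots> = (\<Sum>K\<in>index_lists n q. \<Sum>a<n. \<Sum>c<n.
      h (e a) (e c) * (\<alpha> (map e (K @ [a])) * \<beta> (map e (K @ [c]))))"
  proof (rule sum.cong[OF refl], rule sum.cong[OF refl])
    fix K a assume K: "K \<in> index_lists n q"
    have "(\<Sum>N\<in>index_lists n q. \<Sum>c<n.
        of_bool (K = N) * (h (e a) (e c) * (\<alpha> (map e (K @ [a])) * \<beta> (map e (N @ [c]))))) =
      (\<Sum>N\<in>index_lists n q. if K = N then
        (\<Sum>c<n. h (e a) (e c) * (\<alpha> (map e (K @ [a])) * \<beta> (map e (K @ [c])))) else 0)"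
      by (rule sum.cong) auto
    then show "(\<Sum>N\<in>index_lists n q. \<Sum>c<n.
        of_bool (K = N) * (h (e a) (e c) * (\<alpha> (map e (K @ [a])) * \<beta> (map e (N @ [c]))))) =
      (\<Sum>c<n. h (e a) (e c) * (\<alpha> (map e (K @ [a])) * \<beta> (map e (K @ [c]))))"
      using K by simp
  qed
  finally show ?thesis by (simp add: contraction_def q)
qed

lemma has_derivative_dual_gram_lists:
  assumes frames: "eventually (\<lambda>t. orthonormal_frame (gt t) (m t) (E t)) (nhds 0)"
    and g0: "gt 0 = g"
    and Dg: "\<And>x y. ((\<lambda>t. gt t x y) has_real_derivative h x y) (at 0)"
    and K: "K \<in> index_lists n p" and N: "N \<in> index_lists n p"
  shows "dual_gram_lists (m 0) (E 0) K N = of_bool (K = N)"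
    and "((\<lambda>t. dual_gram_lists (m t) (E t) K N) has_real_derivative - variation h K N) (at 0)"
proof -
  have lt: "K ! k < n" "N ! k < n" if "k < p" for k
    using K N that by (auto simp: index_lists_def subset_iff)
  have M0: "gt 0 (e a) (e b) = of_bool (a = b)" if "a < n" "b < n" for a b
    using that by (simp add: g0 g_basis)
  have inv: "eventually (\<lambda>t. \<forall>a<n. \<forall>c<n.
      (\<Sum>b<n. dual_gram (m t) (E t) a b * gt t (e b) (e c)) = of_bool (a = c)) (nhds 0)"
    using frames by eventually_elim (simp add: dual_gram_left_inverse)
  note D = has_derivative_left_inverse[of n "\<lambda>t a b. gt t (e a) (e b)" "\<lambda>a b. h (e a) (e b)"
      "\<lambda>t. dual_gram (m t) (E t)", OF M0 Dg inv]
  show "dual_gram_lists (m 0) (E 0) K N = of_bool (K = N)"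
    using prod_of_bool_lists[of K p N] lt index_lists_length[OF K] index_lists_length[OF N]
    by (simp add: dual_gram_lists_def D(1))
  have "((\<lambda>t. \<Prod>k<p. dual_gram (m t) (E t) (K ! k) (N ! k)) has_real_derivative
      (\<Sum>k<p. - h (e (K ! k)) (e (N ! k)) *
        (\<Prod>j\<in>{..<p} - {k}. dual_gram (m 0) (E 0) (K ! j) (N ! j)))) (at 0)"
    by (rule has_field_derivative_prod) (use D(2) lt in auto)
  moreover have "(\<Sum>k<p. - h (e (K ! k)) (e (N ! k)) *
      (\<Prod>j\<in>{..<p} - {k}. dual_gram (m 0) (E 0) (K ! j) (N ! j))) = - variation h K N"
    using index_lists_length[OF K] lt
    by (simp add: variation_def D(1) sum_negf cong: prod.cong_simp)
  ultimately show "((\<lambda>t. dual_gram_lists (m t) (E t) K N) has_real_derivative - variation h K N) (at 0)"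
    using index_lists_length[OF K] by (simp add: dual_gram_lists_def)
qed

text \<open>The product rule is applied to the two weights of \<open>frame_inner_change\<close>,
  each a Kronecker symbol at 0. Every resulting term has one pair of arguments frozen and the other
  contracted with \<open>h\<close>, which is what \<open>frame_inner_F_op\<close>
  recognises.\<close>

lemma has_derivative_frame_inner:
  assumes frames: "eventually (\<lambda>t. orthonormal_frame (gt t) (m t) (E t)) (nhds 0)"
    and g0: "gt 0 = g"
    and Dg: "\<And>x y. ((\<lambda>t. gt t x y) has_real_derivative h x y) (at 0)"
    and h: "\<And>y. linear (\<lambda>x. h x y)" "\<And>x. linear (h x)" "\<And>x y. h x y = h y x"
    and p: "p \<ge> 1" and \<omega>: "\<omega> \<in> double_forms p p" and \<eta>: "\<eta> \<in> double_forms p p"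
  shows "((\<lambda>t. orthonormal_frame.frame_inner (m t) (E t) p p \<omega> \<eta>) has_real_derivative
    - frame_inner p p (F_op g h p \<omega>) \<eta>) (at 0)"
proof -
  let ?I = "index_lists n p"
  let ?W = "\<lambda>t. dual_gram_lists (m t) (E t)"
  let ?C = "\<lambda>K P N Q. \<omega> (map e K) (map e P) * \<eta> (map e N) (map e Q)"
  note W = has_derivative_dual_gram_lists[OF frames g0 Dg]
  have "((\<lambda>t. (\<Sum>P\<in>?I. \<Sum>Q\<in>?I. \<Sum>K\<in>?I. \<Sum>N\<in>?I. ?W t P Q * ?W t K N * ?C K P N Q) / (fact p * fact p))
    has_real_derivative (\<Sum>P\<in>?I. \<Sum>Q\<in>?I. \<Sum>K\<in>?I. \<Sum>N\<in>?I.
      (- variation h P Q * of_bool (K = N) + - variation h K N * of_bool (P = Q)) * ?C K P N Q)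
        / (fact p * fact p)) (at 0)"
  proof (intro DERIV_cdivide DERIV_sum DERIV_cmult_right)
    fix P Q K N assume I: "P \<in> ?I" "Q \<in> ?I" "K \<in> ?I" "N \<in> ?I"
    show "((\<lambda>t. ?W t P Q * ?W t K N) has_real_derivative
        - variation h P Q * of_bool (K = N) + - variation h K N * of_bool (P = Q)) (at 0)"
      using DERIV_mult[OF W(2)[OF I(1,2)] W(2)[OF I(3,4)]] W(1)[OF I(1,2)] W(1)[OF I(3,4)] by simp
  qed
  also have "(\<Sum>P\<in>?I. \<Sum>Q\<in>?I. \<Sum>K\<in>?I. \<Sum>N\<in>?I.
      (- variation h P Q * of_bool (K = N) + - variation h K N * of_bool (P = Q)) * ?C K P N Q) =
    - ((\<Sum>K\<in>?I. contraction h p (\<omega> (map e K)) (\<eta> (map e K))) +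
       (\<Sum>P\<in>?I. contraction h p (\<lambda>xs. \<omega> xs (map e P)) (\<lambda>xs. \<eta> xs (map e P))))"
  proof -
    have 1: "(\<Sum>K\<in>?I. \<Sum>N\<in>?I. variation h P Q * of_bool (K = N) * ?C K P N Q) =
        (\<Sum>K\<in>?I. variation h P Q * ?C K P K Q)" for P Q
    proof (rule sum.cong[OF refl])
      fix K assume "K \<in> ?I"
      moreover have "(\<Sum>N\<in>?I. variation h P Q * of_bool (K = N) * ?C K P N Q) =
          (\<Sum>N\<in>?I. if K = N then variation h P Q * ?C K P K Q else 0)"
        by (rule sum.cong) auto
      ultimately show "(\<Sum>N\<in>?I. variation h P Q * of_bool (K = N) * ?C K P N Q) =
          variation h P Q * ?C K P K Q" by simp
    qed
    \<comment> \<open>The symbol for \<open>K = N\<close> freezes the first arguments, and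
      \<open>sum_variation\<close> acts on the second ones.\<close>
    have A: "(\<Sum>P\<in>?I. \<Sum>Q\<in>?I. \<Sum>K\<in>?I. \<Sum>N\<in>?I. variation h P Q * of_bool (K = N) * ?C K P N Q) =
        (\<Sum>K\<in>?I. contraction h p (\<omega> (map e K)) (\<eta> (map e K)))"
      unfolding 1 sum_swap3[of _ ?I ?I ?I]
        sum_variation[OF double_formsD(2)[OF \<omega>] double_formsD(2)[OF \<eta>] p] ..
    \<comment> \<open>The reverse case: the second arguments are frozen.\<close>
    have B: "(\<Sum>P\<in>?I. \<Sum>Q\<in>?I. \<Sum>K\<in>?I. \<Sum>N\<in>?I. variation h K N * of_bool (P = Q) * ?C K P N Q) =
        (\<Sum>P\<in>?I. contraction h p (\<lambda>xs. \<omega> xs (map e P)) (\<lambda>xs. \<eta> xs (map e P)))"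
    proof (rule sum.cong[OF refl])
      fix P assume "P \<in> ?I"
      moreover have "(\<Sum>Q\<in>?I. \<Sum>K\<in>?I. \<Sum>N\<in>?I. variation h K N * of_bool (P = Q) * ?C K P N Q) =
          (\<Sum>Q\<in>?I. if P = Q then \<Sum>K\<in>?I. \<Sum>N\<in>?I. variation h K N * ?C K P N P else 0)"
        by (rule sum.cong) auto
      ultimately have "(\<Sum>Q\<in>?I. \<Sum>K\<in>?I. \<Sum>N\<in>?I. variation h K N * of_bool (P = Q) * ?C K P N Q) =
          (\<Sum>K\<in>?I. \<Sum>N\<in>?I. variation h K N * ?C K P N P)" by simp
      also have "\<dots> = contraction h p (\<lambda>xs. \<omega> xs (map e P)) (\<lambda>xs. \<eta> xs (map e P))"
        by (rule sum_variation[OF double_formsD(1)[OF \<omega>] double_formsD(1)[OF \<eta>] p])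
      finally show "(\<Sum>Q\<in>?I. \<Sum>K\<in>?I. \<Sum>N\<in>?I. variation h K N * of_bool (P = Q) * ?C K P N Q) =
          contraction h p (\<lambda>xs. \<omega> xs (map e P)) (\<lambda>xs. \<eta> xs (map e P))" .
    qed
    show ?thesis
      unfolding A[symmetric] B[symmetric]
      by (simp add: distrib_right sum.distrib sum_negf left_diff_distrib sum_subtractf)
  qed
  also have "- ((\<Sum>K\<in>?I. contraction h p (\<omega> (map e K)) (\<eta> (map e K))) +
       (\<Sum>P\<in>?I. contraction h p (\<lambda>xs. \<omega> xs (map e P)) (\<lambda>xs. \<eta> xs (map e P)))) / (fact p * fact p) =
      - frame_inner p p (F_op g h p \<omega>) \<eta>"
    by (simp only: frame_inner_F_op[OF h p \<omega> \<eta>] minus_divide_left)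
  finally have D: "((\<lambda>t. (\<Sum>P\<in>?I. \<Sum>Q\<in>?I. \<Sum>K\<in>?I. \<Sum>N\<in>?I. ?W t P Q * ?W t K N * ?C K P N Q)
      / (fact p * fact p)) has_real_derivative - frame_inner p p (F_op g h p \<omega>) \<eta>) (at 0)" .
  have ev: "eventually (\<lambda>t. (\<Sum>P\<in>?I. \<Sum>Q\<in>?I. \<Sum>K\<in>?I. \<Sum>N\<in>?I. ?W t P Q * ?W t K N * ?C K P N Q)
      / (fact p * fact p) = orthonormal_frame.frame_inner (m t) (E t) p p \<omega> \<eta>) (nhds 0)"
    using frames by eventually_elim (simp only: frame_inner_change[OF _ \<omega> \<eta>])
  show ?thesis using D DERIV_cong_ev[OF refl ev refl] by blast
qed

end

theorem lemma2p4:
  fixes gt :: "real \<Rightarrow> 'a::real_vector \<Rightarrow> 'a \<Rightarrow> real"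
    and g h :: "'a \<Rightarrow> 'a \<Rightarrow> real"
    and I :: "real set" and p :: nat
    and \<omega>1 \<omega>2 :: "'a dform"
  assumes "\<exists>B :: 'a set. finite B \<and> span B = UNIV"
    and "open I" and "is_interval I" and "0 \<in> I"
    and "smooth_family_of_inner_products I gt"
    and "gt 0 = g"
    and "\<And>x y. ((\<lambda>t. gt t x y) has_real_derivative h x y) (at 0)"
    and "p \<ge> 1"
    and "\<omega>1 \<in> double_forms p p" and "\<omega>2 \<in> double_forms p p"
  shows "((\<lambda>t. induced_inner (gt t) p p \<omega>1 \<omega>2) has_real_derivative
           - induced_inner (gt 0) p p (F_op g h p \<omega>1) \<omega>2) (at 0)"
proof -
  obtain B :: "'a set" where B: "finite B" "span B = UNIV" using assms(1) by blast
  have ip: "inner_product_on UNIV (gt t)" if "t \<in> I" for t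
    using assms(5) that by (simp add: smooth_family_of_inner_products_def)
  \<comment> \<open>One frame for every \<open>t\<close> in \<open>I\<close>, packed as a pair for
    \<open>bchoice\<close>; nothing is claimed about its dependence on \<open>t\<close>.\<close>
  have "\<forall>t\<in>I. \<exists>z. orthonormal_frame (gt t) (fst z) (snd z) \<and>
      (\<forall>\<omega>\<in>double_forms p p. \<forall>\<eta>\<in>double_forms p p.
        induced_inner (gt t) p p \<omega> \<eta> = orthonormal_frame.frame_inner (fst z) (snd z) p p \<omega> \<eta>)"
  proof
    fix t assume "t \<in> I"
    show "\<exists>z. orthonormal_frame (gt t) (fst z) (snd z) \<and>
      (\<forall>\<omega>\<in>double_forms p p. \<forall>\<eta>\<in>double_forms p p.
        induced_inner (gt t) p p \<omega> \<eta> = orthonormal_frame.frame_inner (fst z) (snd z) p p \<omega> \<eta>)"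
    proof (rule induced_inner_eq_frame_inner[OF ip[OF \<open>t \<in> I\<close>] B, of p p])
      fix n e assume "orthonormal_frame (gt t) n e"
        and "\<And>\<omega> \<eta>. \<lbrakk>\<omega> \<in> double_forms p p; \<eta> \<in> double_forms p p\<rbrakk>
          \<Longrightarrow> induced_inner (gt t) p p \<omega> \<eta> = orthonormal_frame.frame_inner n e p p \<omega> \<eta>"
      then show ?thesis by (intro exI[of _ "(n, e)"]) simp
    qed
  qed
  from bchoice[OF this] obtain Z where
    Z: "\<forall>t\<in>I. orthonormal_frame (gt t) (fst (Z t)) (snd (Z t)) \<and>
      (\<forall>\<omega>\<in>double_forms p p. \<forall>\<eta>\<in>double_forms p p. induced_inner (gt t) p p \<omega> \<eta> =
        orthonormal_frame.frame_inner (fst (Z t)) (snd (Z t)) p p \<omega> \<eta>)" ..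
  define m E where "m t = fst (Z t)" and "E t = snd (Z t)" for t
  have frame: "orthonormal_frame (gt t) (m t) (E t)" if "t \<in> I" for t
    using Z that by (simp add: m_def E_def)
  have induced: "induced_inner (gt t) p p \<omega> \<eta> = orthonormal_frame.frame_inner (m t) (E t) p p \<omega> \<eta>"
    if "t \<in> I" "\<omega> \<in> double_forms p p" "\<eta> \<in> double_forms p p" for t \<omega> \<eta>
    using Z that by (simp add: m_def E_def)
  have I: "eventually (\<lambda>t. t \<in> I) (nhds 0)" using assms(2,4) by (rule eventually_nhds_in_open)
  \<comment> \<open>\<open>h\<close> is given only as a pointwise derivative. Its bilinearity and
    symmetry are inherited from \<open>gt t\<close>, because functions that agree on the open set
    \<open>I\<close> have the same derivative at 0.\<close>
  have unique: "d = d'" if "(f has_real_derivative d) (at 0)" "(f' has_real_derivative d') (at 0)"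
    "\<And>t. t \<in> I \<Longrightarrow> f t = f' t" for f f' d d'
  proof -
    have "eventually (\<lambda>t. f t = f' t) (nhds 0)" by (rule eventually_mono[OF I that(3)])
    then have "(f has_real_derivative d') (at 0)"
      using that(2) DERIV_cong_ev[OF refl _ refl, of f f' 0 d'] by blast
    with that(1) show ?thesis by (rule DERIV_unique)
  qed
  note Dg = assms(7) and ipD = inner_product_onD[OF ip]
  have h_lin: "linear (\<lambda>x. h x y)" for y
  proof (rule linearI)
    show "h (x + x') y = h x y + h x' y" for x x'
      by (rule unique[OF Dg DERIV_add[OF Dg Dg]]) (simp add: linear_add[OF ipD(3)])
    show "h (c *\<^sub>R x) y = c *\<^sub>R h x y" for c x
      using unique[OF Dg DERIV_cmult[OF Dg]] linear_scale[OF ipD(3)] by simp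
  qed
  have h_sym: "h x y = h y x" for x y by (rule unique[OF Dg Dg]) (rule ipD(1))
  have h_lin2: "linear (h x)" for x using h_lin[of x] by (simp only: h_sym[of _ x])
  interpret orthonormal_frame g "m 0" "E 0" using frame[OF assms(4)] by (simp only: assms(6))
  have "((\<lambda>t. orthonormal_frame.frame_inner (m t) (E t) p p \<omega>1 \<omega>2) has_real_derivative
      - frame_inner p p (F_op g h p \<omega>1) \<omega>2) (at 0)"
    using eventually_mono[OF I frame]
    by (rule has_derivative_frame_inner[OF _ assms(6) Dg h_lin h_lin2 h_sym assms(8-10)])
  moreover have ev: "eventually (\<lambda>t. orthonormal_frame.frame_inner (m t) (E t) p p \<omega>1 \<omega>2 =
      induced_inner (gt t) p p \<omega>1 \<omega>2) (nhds 0)"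
    by (rule eventually_mono[OF I]) (simp add: induced assms(9,10))
  \<comment> \<open>\<open>induced\<close> speaks of double forms only, so
    \<open>F_op g h p \<omega>1\<close> has to be known to be one.\<close>
  moreover have "frame_inner p p (F_op g h p \<omega>1) \<omega>2 = induced_inner (gt 0) p p (F_op g h p \<omega>1) \<omega>2"
    using F_op_in_double_forms[OF h_lin h_lin2 assms(8,9)]
    by (rule induced[OF assms(4) _ assms(10), symmetric])
  ultimately show ?thesis by (simp only: DERIV_cong_ev[OF refl ev refl])
qed

end
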